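(* Let $S_1,S_2,T_1$ and $T_2$ be Cu-semigroups, and let $\mathbf f=(f_\lambda)_\lambda$ and $\mathbf g=(g_\lambda)_\lambda$ be paths in $\mathrm{Cu}[S_1,T_1]$ and $\mathrm{Cu}[S_2,T_2]$, respectively. For each $\lambda$, consider the generalized Cu-morphism $f_\lambda\otimes g_\lambda\colon S_1\otimes S_2\to T_1\otimes T_2$. Then $(f_\lambda\otimes g_\lambda)_\lambda$ is a path in $\mathrm{Cu}[S_1\otimes S_2,T_1\otimes T_2]$ and $$[\mathbf f]\boxtimes[\mathbf g]=[(f_\lambda\otimes g_\lambda)_\lambda].$$
   Context: A positively ordered semigroup is a commutative monoid $(S,+,0)$ with a partial order $\le$ compatible with addition such that $0\le a$ for all $a$. For $a,b\in S$, $a\ll b$ (way-below) means: whenever $(c_n)_n$ is an increasing sequence in $S$ whose supremum exists and satisfies $b\le\sup_n c_n$, there is $k$ with $a\le c_k$. A Cu-semigroup is a positively ordered semigroup satisfying: (O1) every increasing sequence has a supremum; (O2) every $a$ is the supremum of a sequence $(a_n)_n$ with $a_n\ll a_{n+1}$ for all $n$; (O3) $a'\ll a$ and $b'\ll b$ imply $a'+b'\ll a+b$; (O4) $\sup_n(a_n+b_n)=\sup_n a_n+\sup_n b_n$ for increasing sequences. A generalized Cu-morphism is a map between Cu-semigroups preserving addition, zero, order and suprema of increasing sequences; a Cu-morphism additionally preserves $\ll$. $\mathrm{Cu}[S,T]$ and $\mathrm{Cu}(S,T)$ denote the sets of generalized Cu-morphisms and of Cu-morphisms $S\to T$, with pointwise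 order and addition. A Cu-bimorphism $\varphi\colon S\times T\to P$ is a map that is additive, zero- and order-preserving in each variable, satisfies $\sup_k\varphi(a_k,b_k)=\varphi(\sup_k a_k,\sup_k b_k)$ for increasing sequences, and satisfies $\varphi(a',b')\ll\varphi(a,b)$ whenever $a'\ll a$ and $b'\ll b$. $S\otimes T$ denotes the Cu-semigroup with universal Cu-bimorphism $S\times T\to S\otimes T$, $(a,b)\mapsto a\otimes b$: every Cu-bimorphism $S\times T\to P$ factors through a unique Cu-morphism $S\otimes T\to P$, and Cu-morphisms $\alpha_1,\alpha_2\colon S\otimes T\to P$ satisfy $\alpha_1\le\alpha_2$ iff $\alpha_1(a\otimes b)\le\alpha_2(a\otimes b)$ for all $a,b$. The tensor product is associative and symmetric up to natural isomorphism. For (generalized) Cu-morphisms $\varphi_k\colon S_k\to T_k$, $k=1,2$, $\varphi_1\otimes\varphi_2\colon S_1\otimes S_2\to T_1\otimes T_2$ is the unique (generalized) Cu-morphism with $(\varphi_1\otimes\varphi_2)(a\otimes b)=\varphi_1(a)\otimes\varphi_2(b)$. Let $I_{\mathbb Q}=\mathbb Q\cap(0,1)$. For $\varphi,\psi\in\mathrm{Cu}[S,T]$ write $\varphi\prec\psi$ if $\varphi(a')\ll\psi(a)$ whenever $a'\ll a$ in $S$. A path in $\mathrm{Cu}[S,T]$ is a family $\mathbf f=(f_\lambda)_{\lambda\in I_{\mathbb Q}}$ with $f_{\lambda'}\prec f_\lambda$ whenever $\lambda'<\lambda$. Write $\mathbf f\lesssim\mathbf g$ if for every $\lambda$ there is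 $\mu$ with $f_\lambda\prec g_\mu$. The internal hom $[\![S,T]\!]$ is the set of classes $[\mathbf f]$ of paths modulo ($\mathbf f\lesssim\mathbf g$ and $\mathbf g\lesssim\mathbf f$), with $[\mathbf f]+[\mathbf g]=[(f_\lambda+g_\lambda)_\lambda]$ and $[\mathbf f]\le[\mathbf g]$ iff $\mathbf f\lesssim\mathbf g$; it is a Cu-semigroup. The endpoint map $\sigma_{S,T}\colon[\![S,T]\!]\to\mathrm{Cu}[S,T]$ is $\sigma_{S,T}([\mathbf f])(a)=\sup_\lambda f_\lambda(a)$. It is known that for Cu-semigroups $S,T,P$ there is a bijection $\mathrm{Cu}(S,[\![T,P]\!])\cong\mathrm{Cu}(S\otimes T,P)$ sending $\alpha$ to the Cu-morphism $a\otimes b\mapsto\sigma_{T,P}(\alpha(a))(b)$. The evaluation map $\mathrm e_{S,T}\colon[\![S,T]\!]\otimes S\to T$ is the Cu-morphism corresponding to $\mathrm{id}_{[\![S,T]\!]}$. The external tensor product $\boxtimes\colon[\![S_1,T_1]\!]\otimes[\![S_2,T_2]\!]\to[\![S_1\otimes S_2,T_1\otimes T_2]\!]$, $x_1\otimes x_2\mapsto x_1\boxtimes x_2$, is the Cu-morphism corresponding, under the bijection $\mathrm{Cu}([\![S_1,T_1]\!]\otimes[\![S_2,T_2]\!],[\![S_1\otimes S_2,T_1\otimes T_2]\!])\cong\mathrm{Cu}([\![S_1,T_1]\!]\otimes[\![S_2,T_2]\!]\otimes S_1\otimes S_2,T_1\otimes T_2)$ sending $\alpha$ to the Cu-morphism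 $u\otimes v\mapsto\sigma_{S_1\otimes S_2,T_1\otimes T_2}(\alpha(u))(v)$, to the Cu-morphism $(\mathrm e_{S_1,T_1}\otimes\mathrm e_{S_2,T_2})\circ(\mathrm{id}_{[\![S_1,T_1]\!]}\otimes\sigma\otimes\mathrm{id}_{S_2})\colon[\![S_1,T_1]\!]\otimes[\![S_2,T_2]\!]\otimes S_1\otimes S_2\to T_1\otimes T_2$, where $\sigma\colon[\![S_2,T_2]\!]\otimes S_1\to S_1\otimes[\![S_2,T_2]\!]$ is the flip isomorphism. *)

theory Defs
  imports Complex_Main "HOL-Library.Multiset" "HOL-Library.Countable_Set"
begin

section \<open>Cu-semigroups\<close>

definition (in order) is_lub :: "'a set \<Rightarrow> 'a \<Rightarrow> bool" where
  "is_lub A s \<longleftrightarrow> (\<forall>x\<in>A. x \<le> s) \<and> (\<forall>u. (\<forall>x\<in>A. x \<le> u) \<longrightarrow> s \<le> u)"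

text \<open>Inside the type classes, \<open>monotone (\<le>) (\<le>) c\<close> is what \<open>incseq c\<close> abbreviates.\<close>

definition (in order) way_below :: "'a \<Rightarrow> 'a \<Rightarrow> bool" (infix "\<lless>" 50) where
  "a \<lless> b \<longleftrightarrow>
     (\<forall>(c::nat \<Rightarrow> 'a) s. monotone (\<le>) (\<le>) c \<longrightarrow> is_lub (range c) s \<longrightarrow> b \<le> s \<longrightarrow> (\<exists>k. a \<le> c k))"

text \<open>A Cu-semigroup is a type of the following class; \<open>ordered_comm_monoid_add\<close> provides the
  commutative monoid and the compatible partial order.\<close>

class cu_semigroup = ordered_comm_monoid_add +
  assumes zero_least: "0 \<le> a"
    and O1: "monotone (\<le>) (\<le>) (c :: nat \<Rightarrow> 'a) \<Longrightarrow> \<exists>s. is_lub (range c) s"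
    and O2: "\<exists>c :: nat \<Rightarrow> 'a. (\<forall>n. c n \<lless> c (Suc n)) \<and> is_lub (range c) a"
    and O3: "a' \<lless> a \<Longrightarrow> b' \<lless> b \<Longrightarrow> a' + b' \<lless> a + b"
    and O4: "monotone (\<le>) (\<le>) (c :: nat \<Rightarrow> 'a) \<Longrightarrow> monotone (\<le>) (\<le>) (d :: nat \<Rightarrow> 'a) \<Longrightarrow>
      is_lub (range c) s \<Longrightarrow> is_lub (range d) t \<Longrightarrow> is_lub (range (\<lambda>n. c n + d n)) (s + t)"

lemma is_lubI:
  fixes s :: "'a::order"
  shows "(\<And>x. x \<in> A \<Longrightarrow> x \<le> s) \<Longrightarrow> (\<And>u. (\<And>x. x \<in> A \<Longrightarrow> x \<le> u) \<Longrightarrow> s \<le> u) \<Longrightarrow> is_lub A s"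
  by (auto simp: is_lub_def)

lemma is_lub_upper: "is_lub A (s::'a::order) \<Longrightarrow> x \<in> A \<Longrightarrow> x \<le> s"
  by (auto simp: is_lub_def)

lemma is_lub_least: "is_lub A (s::'a::order) \<Longrightarrow> (\<And>x. x \<in> A \<Longrightarrow> x \<le> u) \<Longrightarrow> s \<le> u"
  by (auto simp: is_lub_def)

lemma is_lub_unique: "is_lub A (s::'a::order) \<Longrightarrow> is_lub A t \<Longrightarrow> s = t"
  by (auto simp: is_lub_def intro: order.antisym)

lemma is_lub_const: "is_lub (range (\<lambda>_::nat. s)) (s::'a::order)"
  by (auto simp: is_lub_def)

lemma is_lub_cofinal:
  fixes s :: "'a::order"
  assumes "is_lub A s" "\<And>x. x \<in> A \<Longrightarrow> \<exists>y\<in>B. x \<le> y" "\<And>y. y \<in> B \<Longrightarrow> \<exists>x\<in>A. y \<le> x"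
  shows "is_lub B s"
proof (rule is_lubI)
  fix y assume "y \<in> B"
  with assms(3) obtain x where "x \<in> A" "y \<le> x" by blast
  with is_lub_upper[OF assms(1)] show "y \<le> s" by (blast intro: order.trans)
next
  fix u assume u: "\<And>y. y \<in> B \<Longrightarrow> y \<le> u"
  show "s \<le> u"
  proof (rule is_lub_least[OF assms(1)])
    fix x assume "x \<in> A"
    with assms(2) obtain y where "y \<in> B" "x \<le> y" by blast
    with u show "x \<le> u" by (blast intro: order.trans)
  qed
qed

definition the_lub :: "'a::cu_semigroup set \<Rightarrow> 'a" where
  "the_lub A = (THE s. is_lub A s)"

lemma the_lub_eqI: "is_lub A s \<Longrightarrow> the_lub A = s"
  unfolding the_lub_def by (rule the_equality) (auto intro: is_lub_unique)

lemma way_belowD: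
  fixes a :: "'a::order" and c :: "nat \<Rightarrow> 'a"
  shows "a \<lless> b \<Longrightarrow> incseq c \<Longrightarrow> is_lub (range c) s \<Longrightarrow> b \<le> s \<Longrightarrow> \<exists>k. a \<le> c k"
  unfolding way_below_def by blast

lemma way_below_imp_le: "a \<lless> b \<Longrightarrow> a \<le> (b::'a::order)"
  using way_belowD[of a b "\<lambda>_. b" b] is_lub_const[of b] by (auto simp: monotone_def)

lemma le_way_below_trans: "a \<le> b \<Longrightarrow> b \<lless> c \<Longrightarrow> a \<lless> (c::'a::order)"
  unfolding way_below_def by (meson order.trans)

lemma way_below_le_trans: "a \<lless> b \<Longrightarrow> b \<le> c \<Longrightarrow> a \<lless> (c::'a::order)"
  unfolding way_below_def by (meson order.trans)

lemma way_below_trans: "a \<lless> b \<Longrightarrow> b \<lless> c \<Longrightarrow> a \<lless> (c::'a::order)"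
  by (blast intro: le_way_below_trans way_below_imp_le)

lemma zero_way_below: "0 \<lless> (a::'a::cu_semigroup)"
  unfolding way_below_def by (auto simp: zero_least)

lemma rapid_incseq: "(\<And>n. c n \<lless> c (Suc n)) \<Longrightarrow> incseq (c :: nat \<Rightarrow> 'a::order)"
  by (rule incseq_SucI) (rule way_below_imp_le)

lemma cu_approx:
  fixes a :: "'a::cu_semigroup"
  obtains c where "\<And>n. c n \<lless> c (Suc n)" "incseq c" "\<And>n. c n \<lless> a" "is_lub (range c) a"
proof -
  obtain c where c: "\<forall>n. c n \<lless> c (Suc n)" "is_lub (range c) a" using O2[of a] by blast
  moreover have "c n \<lless> a" for n
    using c is_lub_upper[OF c(2), of "c (Suc n)"] by (blast intro: way_below_le_trans)
  ultimately show ?thesis using that rapid_incseq by blast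
qed

lemma way_below_approx:
  assumes "x \<lless> a" "incseq c" "is_lub (range c) (a::'a::cu_semigroup)"
  obtains k where "x \<le> c k"
  using way_belowD[OF assms] by auto

lemma way_below_interp:
  fixes a b :: "'a::cu_semigroup"
  assumes "x \<lless> a" "y \<lless> a"
  obtains z where "x \<lless> z" "y \<lless> z" "z \<lless> a"
proof -
  obtain c where c: "\<And>n. c n \<lless> c (Suc n)" "incseq c" "\<And>n. c n \<lless> a" "is_lub (range c) a"
    by (rule cu_approx[of a]) blast
  obtain k where k: "x \<le> c k" by (rule way_below_approx[OF assms(1) c(2,4)])
  obtain l where l: "y \<le> c l" by (rule way_below_approx[OF assms(2) c(2,4)])
  have *: "c i \<lless> c (Suc (max k l))" if "i = k \<or> i = l" for i
    using that c(1)[of "max k l"] incseqD[OF c(2), of i "max k l"] by (auto intro: le_way_below_trans)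
  show ?thesis
    by (rule that[OF le_way_below_trans[OF k *] le_way_below_trans[OF l *] c(3)]) auto
qed

lemma way_below_add_split:
  fixes a b :: "'a::cu_semigroup"
  assumes "x \<lless> a + b"
  obtains a' b' where "a' \<lless> a" "b' \<lless> b" "x \<le> a' + b'"
proof -
  obtain c where c: "incseq c" "\<And>n. c n \<lless> a" "is_lub (range c) a" using cu_approx[of a] by metis
  obtain d where d: "incseq d" "\<And>n. d n \<lless> b" "is_lub (range d) b" using cu_approx[of b] by metis
  have "incseq (\<lambda>n. c n + d n)" using c(1) d(1) by (auto simp: monotone_def intro: add_mono)
  with way_belowD[OF assms, of "\<lambda>n. c n + d n"] O4[OF c(1) d(1) c(3) d(3)] obtain k
    where "x \<le> c k + d k" by blast
  with c d that show ?thesis by blast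
qed

lemma le_if_way_below_le:
  fixes a b :: "'a::cu_semigroup"
  shows "(\<And>x. x \<lless> a \<Longrightarrow> x \<le> b) \<Longrightarrow> a \<le> b"
  by (metis cu_approx[of a] is_lub_least rangeE)

definition gen_cu_morphism :: "('a::cu_semigroup \<Rightarrow> 'b::cu_semigroup) \<Rightarrow> bool" where
  "gen_cu_morphism f \<longleftrightarrow>
     f 0 = 0 \<and> (\<forall>a b. f (a + b) = f a + f b) \<and> mono f \<and>
     (\<forall>c s. incseq c \<longrightarrow> is_lub (range c) s \<longrightarrow> is_lub (range (\<lambda>n. f (c n))) (f s))"

definition cu_morphism :: "('a::cu_semigroup \<Rightarrow> 'b::cu_semigroup) \<Rightarrow> bool" where
  "cu_morphism f \<longleftrightarrow> gen_cu_morphism f \<and> (\<forall>a' a. a' \<lless> a \<longrightarrow> f a' \<lless> f a)"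

definition gen_cu_bimorphism :: "('a::cu_semigroup \<Rightarrow> 'b::cu_semigroup \<Rightarrow> 'c::cu_semigroup) \<Rightarrow> bool" where
  "gen_cu_bimorphism \<phi> \<longleftrightarrow>
     (\<forall>a. \<phi> a 0 = 0) \<and> (\<forall>b. \<phi> 0 b = 0) \<and>
     (\<forall>a a' b. \<phi> (a + a') b = \<phi> a b + \<phi> a' b) \<and> (\<forall>a b b'. \<phi> a (b + b') = \<phi> a b + \<phi> a b') \<and>
     (\<forall>a a' b. a \<le> a' \<longrightarrow> \<phi> a b \<le> \<phi> a' b) \<and> (\<forall>a b b'. b \<le> b' \<longrightarrow> \<phi> a b \<le> \<phi> a b') \<and>
     (\<forall>c d s t. incseq c \<longrightarrow> incseq d \<longrightarrow> is_lub (range c) s \<longrightarrow> is_lub (range d) t \<longrightarrow>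
        is_lub (range (\<lambda>k. \<phi> (c k) (d k))) (\<phi> s t))"

definition cu_bimorphism :: "('a::cu_semigroup \<Rightarrow> 'b::cu_semigroup \<Rightarrow> 'c::cu_semigroup) \<Rightarrow> bool" where
  "cu_bimorphism \<phi> \<longleftrightarrow>
     gen_cu_bimorphism \<phi> \<and> (\<forall>a' a b' b. a' \<lless> a \<longrightarrow> b' \<lless> b \<longrightarrow> \<phi> a' b' \<lless> \<phi> a b)"

section \<open>Tensor products\<close>

text \<open>The tensor product is realized as the Cu-completion of the free commutative monoid on
  pairs, with \<open>tle\<close> the additive preorder generated by bilinearity and positivity, and \<open>tprec\<close>
  the auxiliary relation generated by \<open>way_below\<close> in both factors; its elements are the
  countably generated round ideals for \<open>tprec\<close>. The universal property, which determines the tensor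
  product, is \<open>tensor_universal\<close> and \<open>tensor_morphism_le_iff\<close> below.\<close>

inductive tle :: "('a::cu_semigroup \<times> 'b::cu_semigroup) multiset \<Rightarrow> ('a \<times> 'b) multiset \<Rightarrow> bool" where
  refl: "tle x x"
| trans: "tle x y \<Longrightarrow> tle y z \<Longrightarrow> tle x z"
| add: "tle x y \<Longrightarrow> tle x' y' \<Longrightarrow> tle (x + x') (y + y')"
| mono: "a \<le> a' \<Longrightarrow> b \<le> b' \<Longrightarrow> tle {#(a, b)#} {#(a', b')#}"
| split_left: "tle {#(a + a', b)#} {#(a, b), (a', b)#}"
| merge_left: "tle {#(a, b), (a', b)#} {#(a + a', b)#}"
| split_right: "tle {#(a, b + b')#} {#(a, b), (a, b')#}"
| merge_right: "tle {#(a, b), (a, b')#} {#(a, b + b')#}"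
| zero_left: "tle {#(0, b)#} {#}"
| zero_right: "tle {#(a, 0)#} {#}"
| least: "tle {#} x"

definition twb :: "('a::cu_semigroup \<times> 'b::cu_semigroup) multiset \<Rightarrow> ('a \<times> 'b) multiset \<Rightarrow> bool" where
  "twb = rel_mset (\<lambda>(a', b') (a, b). a' \<lless> a \<and> b' \<lless> b)"

definition tprec :: "('a::cu_semigroup \<times> 'b::cu_semigroup) multiset \<Rightarrow> ('a \<times> 'b) multiset \<Rightarrow> bool" where
  "tprec x y \<longleftrightarrow> (\<exists>u v. tle x u \<and> twb u v \<and> tle v y)"

definition tideal :: "('a::cu_semigroup \<times> 'b::cu_semigroup) multiset set \<Rightarrow> bool" where
  "tideal I \<longleftrightarrow>
     {#} \<in> I \<and> (\<forall>x y. tprec x y \<longrightarrow> y \<in> I \<longrightarrow> x \<in> I) \<and>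
     (\<forall>x\<in>I. \<forall>y\<in>I. \<exists>z\<in>I. tprec x z \<and> tprec y z) \<and>
     (\<exists>D. countable D \<and> D \<subseteq> I \<and> (\<forall>x\<in>I. \<exists>y\<in>D. tprec x y))"


lemma twb_empty_iff [simp]: "twb {#} v \<longleftrightarrow> v = {#}" "twb u {#} \<longleftrightarrow> u = {#}"
  unfolding twb_def using rel_mset_size by (fastforce simp: rel_mset_Zero)+

lemma twb_add_mset:
  "a' \<lless> a \<Longrightarrow> b' \<lless> b \<Longrightarrow> twb u v \<Longrightarrow> twb (add_mset (a', b') u) (add_mset (a, b) v)"
  unfolding twb_def by (rule rel_mset_Plus) auto

lemma twb_add_msetE:
  assumes "twb u (add_mset (a, b) v)"
  obtains a' b' u' where "u = add_mset (a', b') u'" "a' \<lless> a" "b' \<lless> b" "twb u' v"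
  using msed_rel_invR[OF assms[unfolded twb_def]] that unfolding twb_def by auto

lemma twb_singleE:
  assumes "twb u {#(a, b)#}"
  obtains a' b' where "u = {#(a', b')#}" "a' \<lless> a" "b' \<lless> b"
  by (rule twb_add_msetE[OF assms]) (use that in auto)

lemma twb_plus: "twb u v \<Longrightarrow> twb u' v' \<Longrightarrow> twb (u + u') (v + v')"
proof (induction v arbitrary: u)
  case (add p v)
  obtain a b where p: "p = (a, b)" by (cases p)
  from add.prems(1) obtain a' b' w where "u = add_mset (a', b') w" "a' \<lless> a" "b' \<lless> b" "twb w v"
    unfolding p by (rule twb_add_msetE)
  with add p show ?case by (auto intro!: twb_add_mset)
qed auto

lemma twb_plusE:
  assumes "twb u (v + v')"
  obtains w w' where "u = w + w'" "twb w v" "twb w' v'"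
  using assms
proof (induction v arbitrary: u thesis)
  case empty
  then show ?case by auto
next
  case (add p v)
  obtain a b where p: "p = (a, b)" by (cases p)
  from add.prems(2) obtain a' b' x where x: "u = add_mset (a', b') x" "a' \<lless> a" "b' \<lless> b" "twb x (v + v')"
    unfolding p by (auto elim: twb_add_msetE)
  from add.IH[OF _ x(4)] obtain w w' where "x = w + w'" "twb w v" "twb w' v'" by blast
  with x p show ?case by (intro add.prems(1)[of "add_mset (a', b') w" w']) (auto intro: twb_add_mset)
qed

lemma twb_zero: "twb (image_mset (\<lambda>_. (0, 0)) x) x"
  by (induction x) (auto intro: twb_add_mset zero_way_below)

lemma tle_add_mset: "a' \<le> a \<Longrightarrow> b' \<le> b \<Longrightarrow> tle u v \<Longrightarrow> tle (add_mset (a', b') u) (add_mset (a, b) v)"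
  using tle.add[OF tle.mono] by (metis add_mset_add_single union_commute)

lemma twb_imp_tle: "twb u v \<Longrightarrow> tle u v"
proof (induction v arbitrary: u)
  case empty
  then show ?case by (auto intro: tle.refl)
next
  case (add p v)
  obtain a b where p: "p = (a, b)" by (cases p)
  from add.prems(1) obtain a' b' w where "u = add_mset (a', b') w" "a' \<lless> a" "b' \<lless> b" "twb w v"
    unfolding p by (rule twb_add_msetE)
  with add p show ?case by (auto intro!: tle_add_mset way_below_imp_le)
qed

lemma twb_tle: "tle v y \<Longrightarrow> twb u v \<Longrightarrow> \<exists>w. tle u w \<and> twb w y"
proof (induction arbitrary: u rule: tle.induct)
  case (refl x)
  then show ?case by (blast intro: tle.refl)
next
  case (trans x y z)
  then show ?case by (meson tle.trans)
next
  case (add x y x' y')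
  from add.prems obtain w w' where "u = w + w'" "twb w x" "twb w' x'" by (rule twb_plusE)
  with add.IH show ?case by (meson tle.add twb_plus)
next
  case (mono a a' b b')
  from mono.prems obtain x y where "u = {#(x, y)#}" "x \<lless> a" "y \<lless> b" by (rule twb_singleE)
  with mono.hyps show ?case
    by (intro exI[of _ u]) (auto intro!: tle.refl twb_add_mset intro: way_below_le_trans)
next
  case (split_left a a' b)
  then obtain x y where u: "u = {#(x, y)#}" "x \<lless> a + a'" "y \<lless> b" by (rule twb_singleE)
  from way_below_add_split[OF u(2)] obtain p p' where p: "p \<lless> a" "p' \<lless> a'" "x \<le> p + p'" .
  have "tle u {#(p + p', y)#}" using u p by (auto intro: tle.mono)
  from tle.trans[OF this tle.split_left] u p show ?case
    by (intro exI[of _ "{#(p, y), (p', y)#}"]) (auto intro!: twb_add_mset)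
next
  case (merge_left a b a')
  then obtain x y x' y' where u: "u = {#(x, y), (x', y')#}" "x \<lless> a" "y \<lless> b" "x' \<lless> a'" "y' \<lless> b"
    by (auto elim!: twb_add_msetE)
  obtain z where z: "y \<lless> z" "y' \<lless> z" "z \<lless> b" using way_below_interp[OF u(3,5)] .
  have "tle u {#(x, z), (x', z)#}"
    unfolding u(1) using z by (intro tle_add_mset tle.refl) (auto intro: way_below_imp_le)
  from tle.trans[OF this tle.merge_left] u z show ?case
    by (intro exI[of _ "{#(x + x', z)#}"]) (auto intro!: twb_add_mset O3)
next
  case (split_right a b b')
  then obtain x y where u: "u = {#(x, y)#}" "x \<lless> a" "y \<lless> b + b'" by (rule twb_singleE)
  from way_below_add_split[OF u(3)] obtain p p' where p: "p \<lless> b" "p' \<lless> b'" "y \<le> p + p'" .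
  have "tle u {#(x, p + p')#}" using u p by (auto intro: tle.mono)
  from tle.trans[OF this tle.split_right] u p show ?case
    by (intro exI[of _ "{#(x, p), (x, p')#}"]) (auto intro!: twb_add_mset)
next
  case (merge_right a b b')
  then obtain x y x' y' where u: "u = {#(x, y), (x', y')#}" "x \<lless> a" "y \<lless> b" "x' \<lless> a" "y' \<lless> b'"
    by (auto elim!: twb_add_msetE)
  obtain z where z: "x \<lless> z" "x' \<lless> z" "z \<lless> a" using way_below_interp[OF u(2,4)] .
  have "tle u {#(z, y), (z, y')#}"
    unfolding u(1) using z by (intro tle_add_mset tle.refl) (auto intro: way_below_imp_le)
  from tle.trans[OF this tle.merge_right] u z show ?case
    by (intro exI[of _ "{#(z, y + y')#}"]) (auto intro!: twb_add_mset O3)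
next
  case (zero_left b)
  then obtain x y where "u = {#(x, y)#}" "x \<lless> 0" "y \<lless> b" by (rule twb_singleE)
  then have "tle u {#(0, y)#}" by (auto intro: tle.mono way_below_imp_le)
  from tle.trans[OF this tle.zero_left] show ?case by auto
next
  case (zero_right a)
  then obtain x y where "u = {#(x, y)#}" "x \<lless> a" "y \<lless> 0" by (rule twb_singleE)
  then have "tle u {#(x, 0)#}" by (auto intro: tle.mono way_below_imp_le)
  from tle.trans[OF this tle.zero_right] show ?case by auto
next
  case (least x)
  then show ?case using twb_zero[of x] by (auto intro: tle.least)
qed

lemma tprec_iff: "tprec x y \<longleftrightarrow> (\<exists>w. tle x w \<and> twb w y)"
  unfolding tprec_def using twb_tle by (meson tle.refl tle.trans)

lemma tprec_imp_tle: "tprec x y \<Longrightarrow> tle x y"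
  unfolding tprec_def by (meson tle.trans twb_imp_tle)

lemma tle_tprec_trans: "tle x y \<Longrightarrow> tprec y z \<Longrightarrow> tprec x z"
  unfolding tprec_def by (meson tle.trans)

lemma tprec_tle_trans: "tprec x y \<Longrightarrow> tle y z \<Longrightarrow> tprec x z"
  unfolding tprec_def by (meson tle.trans)

lemma tprec_trans: "tprec x y \<Longrightarrow> tprec y z \<Longrightarrow> tprec x z"
  by (blast intro: tle_tprec_trans tprec_imp_tle)

lemma tprec_add: "tprec x y \<Longrightarrow> tprec x' y' \<Longrightarrow> tprec (x + x') (y + y')"
  unfolding tprec_iff by (meson tle.add twb_plus)

lemma twb_imp_tprec: "twb x y \<Longrightarrow> tprec x y"
  unfolding tprec_def by (meson tle.refl)

lemma tprec_empty: "tprec {#} x"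
  unfolding tprec_iff using twb_zero[of x] tle.least by blast

lemma twb_approx:
  "\<exists>w :: nat \<Rightarrow> _. (\<forall>n. twb (w n) (w (Suc n))) \<and> (\<forall>n. twb (w n) y) \<and> (\<forall>u. twb u y \<longrightarrow> (\<exists>n. tle u (w n)))"
proof (induction y)
  case empty
  show ?case by (intro exI[of _ "\<lambda>_. {#}"]) (auto intro: tle.refl)
next
  case (add p y)
  obtain a b where p: "p = (a, b)" by (cases p)
  obtain w where w: "\<And>n. twb (w n) (w (Suc n))" "\<And>n. twb (w n) y" "\<And>u. twb u y \<Longrightarrow> \<exists>n. tle u (w n)"
    using add.IH by blast
  obtain c where c: "\<And>n. c n \<lless> c (Suc n)" "incseq c" "\<And>n. c n \<lless> a" "is_lub (range c) a"
    by (rule cu_approx[of a]) blast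
  obtain d where d: "\<And>n. d n \<lless> d (Suc n)" "incseq d" "\<And>n. d n \<lless> b" "is_lub (range d) b"
    by (rule cu_approx[of b]) blast
  have wle: "tle (w m) (w n)" if "m \<le> n" for m n
    using that by (induction rule: dec_induct) (auto intro: tle.refl tle.trans twb_imp_tle w(1))
  have "\<exists>n. tle u (add_mset (c n, d n) (w n))" if u: "twb u (add_mset p y)" for u
  proof -
    obtain a' b' v where v: "u = add_mset (a', b') v" "a' \<lless> a" "b' \<lless> b" "twb v y"
      using u unfolding p by (rule twb_add_msetE)
    obtain k where k: "a' \<le> c k" by (rule way_below_approx[OF v(2) c(2,4)])
    obtain l where l: "b' \<le> d l" by (rule way_below_approx[OF v(3) d(2,4)])
    obtain m where m: "tle v (w m)" using w(3)[OF v(4)] by blast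
    define n where "n = max k (max l m)"
    have "a' \<le> c n" using k incseqD[OF c(2), of k n] by (auto simp: n_def intro: order.trans)
    moreover have "b' \<le> d n" using l incseqD[OF d(2), of l n] by (auto simp: n_def intro: order.trans)
    moreover have "tle v (w n)" using m wle[of m n] by (auto simp: n_def intro: tle.trans)
    ultimately show ?thesis unfolding v(1) by (blast intro: tle_add_mset)
  qed
  then show ?case
    by (intro exI[of _ "\<lambda>n. add_mset (c n, d n) (w n)"])
      (auto simp: p intro!: twb_add_mset c d w)
qed

lemma tprec_approx:
  obtains w :: "nat \<Rightarrow> _"
  where "\<And>n. tprec (w n) (w (Suc n))" "\<And>n. tprec (w n) y" "\<And>u. tprec u y \<Longrightarrow> \<exists>n. tprec u (w n)"
proof -
  obtain w where w: "\<And>n. twb (w n) (w (Suc n))" "\<And>n. twb (w n) y" "\<And>u. twb u y \<Longrightarrow> \<exists>n. tle u (w n)"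
    using twb_approx[of y] by blast
  have "\<exists>n. tprec u (w n)" if u: "tprec u y" for u
  proof -
    obtain v where v: "tle u v" "twb v y" using u unfolding tprec_iff by blast
    then obtain n where n: "tle v (w n)" using w(3) by blast
    have "tprec u (w (Suc n))"
      using tle_tprec_trans[OF tle.trans[OF v(1) n] twb_imp_tprec[OF w(1)]] .
    then show ?thesis ..
  qed
  with w show ?thesis using that twb_imp_tprec by blast
qed

lemma tprec_chain:
  assumes "\<And>n. tprec (w n) (w (Suc n))" "m < n"
  shows "tprec (w m) (w n)"
  using assms(2) by (induction rule: less_Suc_induct) (auto intro: assms(1) tprec_trans)

lemma tideal_seqI:
  assumes w: "\<And>n::nat. tprec (w n) (w (Suc n))"
  shows "tideal {x. \<exists>n. tprec x (w n)}"
proof -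
  have mem: "w n \<in> {x. \<exists>n. tprec x (w n)}" for n using w by blast
  moreover have dir: "\<exists>z\<in>range w. tprec x z \<and> tprec y z" if "tprec x (w m)" "tprec y (w n)" for x y m n
  proof -
    have "tprec (w m) (w (Suc (max m n)))" "tprec (w n) (w (Suc (max m n)))"
      using tprec_chain[of w, OF w] by auto
    with that show ?thesis by (blast intro: tprec_trans)
  qed
  moreover have "countable (range w)" by simp
  ultimately have "\<exists>D. countable D \<and> D \<subseteq> {x. \<exists>n. tprec x (w n)} \<and>
      (\<forall>x\<in>{x. \<exists>n. tprec x (w n)}. \<exists>y\<in>D. tprec x y)"
    by (intro exI[of _ "range w"]) auto
  moreover have "\<forall>x\<in>{x. \<exists>n. tprec x (w n)}. \<forall>y\<in>{x. \<exists>n. tprec x (w n)}.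
      \<exists>z\<in>{x. \<exists>n. tprec x (w n)}. tprec x z \<and> tprec y z"
    using mem dir by blast
  moreover have "{#} \<in> {x. \<exists>n. tprec x (w n)}" by (blast intro: tprec_empty)
  moreover have "\<forall>x y. tprec x y \<longrightarrow> y \<in> {x. \<exists>n. tprec x (w n)} \<longrightarrow> x \<in> {x. \<exists>n. tprec x (w n)}"
    by (blast dest: tprec_trans)
  ultimately show ?thesis
    unfolding tideal_def by (intro conjI)
qed

lemma tideal_empty: "tideal I \<Longrightarrow> {#} \<in> I"
  by (simp add: tideal_def)

lemma tideal_down: "tideal I \<Longrightarrow> tprec x y \<Longrightarrow> y \<in> I \<Longrightarrow> x \<in> I"
  unfolding tideal_def by (elim conjE) blast

lemma tideal_dir: "tideal I \<Longrightarrow> x \<in> I \<Longrightarrow> y \<in> I \<Longrightarrow> \<exists>z\<in>I. tprec x z \<and> tprec y z"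
  by (simp add: tideal_def)

lemma tideal_countable: "tideal I \<Longrightarrow> \<exists>D. countable D \<and> D \<subseteq> I \<and> (\<forall>x\<in>I. \<exists>y\<in>D. tprec x y)"
  by (simp add: tideal_def)

lemma tideal_seqE:
  assumes "tideal I"
  obtains w :: "nat \<Rightarrow> _"
  where "\<And>n. tprec (w n) (w (Suc n))" "\<And>n. w n \<in> I" "\<And>x. x \<in> I \<Longrightarrow> \<exists>n. tprec x (w n)"
proof -
  obtain D where D: "countable D" "D \<subseteq> I" "\<And>x. x \<in> I \<Longrightarrow> \<exists>y\<in>D. tprec x y"
    using tideal_countable[OF assms] by blast
  note empty = tideal_empty[OF assms] and dir = tideal_dir[OF assms]
  have "D \<noteq> {}" using D(3)[OF empty] by blast
  define d where "d = from_nat_into D"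
  have d: "range d = D" unfolding d_def using \<open>D \<noteq> {}\<close> D(1) by (rule range_from_nat_into)
  have "\<exists>w. \<forall>n. w n \<in> I \<and> (tprec (w n) (w (Suc n)) \<and> tprec (d n) (w (Suc n)))"
  proof (rule dependent_nat_choice)
    show "\<exists>x. x \<in> I" using empty by blast
    fix x n assume "x \<in> I"
    moreover have "d n \<in> I" using d D(2) by blast
    ultimately show "\<exists>y. y \<in> I \<and> (tprec x y \<and> tprec (d n) y)" using dir by blast
  qed
  then obtain w where w: "\<And>n. w n \<in> I" "\<And>n. tprec (w n) (w (Suc n))" "\<And>n. tprec (d n) (w (Suc n))"
    by blast
  have "\<exists>n. tprec x (w n)" if "x \<in> I" for x
  proof -
    from that obtain n where "tprec x (d n)" using D(3) d by blast
    with w(3) show "\<exists>n. tprec x (w n)" by (blast intro: tprec_trans)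
  qed
  then show ?thesis by (rule that[of w, OF w(2,1)])
qed

lemma tideal_round: "tideal I \<Longrightarrow> x \<in> I \<Longrightarrow> \<exists>z\<in>I. tprec x z"
  using tideal_dir by blast

lemma tideal_tprec: "tideal {x. tprec x y}"
proof -
  obtain w where w: "\<And>n. tprec (w n) (w (Suc n))" "\<And>n. tprec (w n) y" "\<And>u. tprec u y \<Longrightarrow> \<exists>n. tprec u (w n)"
    by (rule tprec_approx[of y]) blast
  have "{x. tprec x y} = {x. \<exists>n. tprec x (w n)}" using w(3) tprec_trans[OF _ w(2)] by blast
  with tideal_seqI[of w, OF w(1)] show ?thesis by simp
qed

lemma tideal_Union:
  assumes "\<And>n::nat. tideal (J n)" "\<And>m n. m \<le> n \<Longrightarrow> J m \<subseteq> J n"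
  shows "tideal (\<Union>n. J n)"
proof -
  have "\<exists>D. \<forall>n. countable (D n) \<and> D n \<subseteq> J n \<and> (\<forall>x\<in>J n. \<exists>y\<in>D n. tprec x y)"
    using tideal_countable[OF assms(1)] by (intro choice allI)
  then obtain D where D: "\<And>n. countable (D n)" "\<And>n. D n \<subseteq> J n" "\<And>n x. x \<in> J n \<Longrightarrow> \<exists>y\<in>D n. tprec x y"
    by metis
  have "\<exists>z\<in>\<Union>n. J n. tprec x z \<and> tprec y z" if "x \<in> J m" "y \<in> J n" for x y m n
    using tideal_dir[OF assms(1)[of "max m n"], of x y] that assms(2)[of m "max m n"] assms(2)[of n "max m n"]
    by auto
  moreover have "{#} \<in> (\<Union>n. J n)" using tideal_empty[OF assms(1)] by blast
  moreover have "x \<in> (\<Union>n. J n)" if "tprec x y" "y \<in> (\<Union>n. J n)" for x y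
    using tideal_down[OF assms(1) that(1)] that(2) by blast
  moreover have "\<exists>D. countable D \<and> D \<subseteq> (\<Union>n. J n) \<and> (\<forall>x\<in>\<Union>n. J n. \<exists>y\<in>D. tprec x y)"
  proof (intro exI[of _ "\<Union>n. D n"] conjI ballI)
    show "countable (\<Union>n. D n)" using D(1) by simp
    show "(\<Union>n. D n) \<subseteq> (\<Union>n. J n)" using D(2) by blast
    fix x assume "x \<in> (\<Union>n. J n)"
    then show "\<exists>y\<in>\<Union>n. D n. tprec x y" using D(3) by blast
  qed
  ultimately show ?thesis unfolding tideal_def by (intro conjI) (blast | assumption)+
qed

lemma tideal_add:
  assumes I: "tideal I" and J: "tideal J"
  shows "tideal {x. \<exists>u\<in>I. \<exists>v\<in>J. tprec x (u + v)}"
proof -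
  obtain w where w: "\<And>n. tprec (w n) (w (Suc n))" "\<And>n. w n \<in> I" "\<And>x. x \<in> I \<Longrightarrow> \<exists>n. tprec x (w n)"
    by (rule tideal_seqE[OF I]) blast
  obtain z where z: "\<And>n. tprec (z n) (z (Suc n))" "\<And>n. z n \<in> J" "\<And>x. x \<in> J \<Longrightarrow> \<exists>n. tprec x (z n)"
    by (rule tideal_seqE[OF J]) blast
  have "{x. \<exists>u\<in>I. \<exists>v\<in>J. tprec x (u + v)} = {x. \<exists>n. tprec x (w n + z n)}"
  proof safe
    fix x u v assume x: "u \<in> I" "v \<in> J" "tprec x (u + v)"
    obtain m where m: "tprec u (w m)" using x w(3) by blast
    obtain n where n: "tprec v (z n)" using x z(3) by blast
    have "tprec u (w (Suc (max m n)))"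
      by (rule tprec_trans[OF m tprec_chain[of w, OF w(1)]]) simp
    moreover have "tprec v (z (Suc (max m n)))"
      by (rule tprec_trans[OF n tprec_chain[of z, OF z(1)]]) simp
    ultimately show "\<exists>n. tprec x (w n + z n)" using x(3) tprec_add tprec_trans by blast
  next
    fix x n assume "tprec x (w n + z n)"
    then show "\<exists>u\<in>I. \<exists>v\<in>J. tprec x (u + v)" using w(2) z(2) by blast
  qed
  moreover have "tideal {x. \<exists>n. tprec x (w n + z n)}"
    by (rule tideal_seqI) (intro tprec_add w z)
  ultimately show ?thesis by simp
qed

typedef (overloaded) ('a::cu_semigroup, 'b::cu_semigroup) tensor (infixr "\<otimes>" 75) =
  "{I :: ('a \<times> 'b) multiset set. tideal I}"
  by (rule exI[of _ "{x. tprec x {#}}"]) (simp add: tideal_tprec)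

setup_lifting type_definition_tensor

instantiation tensor :: (cu_semigroup, cu_semigroup) order
begin

lift_definition less_eq_tensor :: "'a \<otimes> 'b \<Rightarrow> 'a \<otimes> 'b \<Rightarrow> bool" is "(\<subseteq>)" .

definition less_tensor :: "'a \<otimes> 'b \<Rightarrow> 'a \<otimes> 'b \<Rightarrow> bool" where
  "less_tensor I J \<longleftrightarrow> I \<le> J \<and> \<not> J \<le> I"

instance
proof
  fix I J K :: "'a \<otimes> 'b"
  show "I < J \<longleftrightarrow> I \<le> J \<and> \<not> J \<le> I" by (rule less_tensor_def)
qed (transfer; blast)+

end

instantiation tensor :: (cu_semigroup, cu_semigroup) "{plus, zero}"
begin

lift_definition zero_tensor :: "'a \<otimes> 'b" is "{x. tprec x {#}}"
  by (rule tideal_tprec)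

lift_definition plus_tensor :: "'a \<otimes> 'b \<Rightarrow> 'a \<otimes> 'b \<Rightarrow> 'a \<otimes> 'b"
  is "\<lambda>I J. {x. \<exists>u\<in>I. \<exists>v\<in>J. tprec x (u + v)}"
  by (rule tideal_add)

instance ..

end

lift_definition tdown :: "('a::cu_semigroup \<times> 'b::cu_semigroup) multiset \<Rightarrow> 'a \<otimes> 'b"
  is "\<lambda>y. {x. tprec x y}" by (rule tideal_tprec)

lemma tensor_lub_iff:
  fixes c :: "nat \<Rightarrow> 'a::cu_semigroup \<otimes> 'b::cu_semigroup"
  assumes "incseq c"
  shows "is_lub (range c) s \<longleftrightarrow> Rep_tensor s = (\<Union>n. Rep_tensor (c n))"
proof -
  have "tideal (\<Union>n. Rep_tensor (c n))"
    using incseqD[OF assms] Rep_tensor by (intro tideal_Union) (auto simp: less_eq_tensor.rep_eq)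
  then obtain t where t: "Rep_tensor t = (\<Union>n. Rep_tensor (c n))"
    by (metis Rep_tensor_cases mem_Collect_eq)
  then have "is_lub (range c) t"
    by (intro is_lubI) (auto simp: less_eq_tensor.rep_eq)
  then show ?thesis using t by (metis is_lub_unique Rep_tensor_inject)
qed

lemma tideal_Rep: "tideal (Rep_tensor I)"
  using Rep_tensor[of I] by simp

lemma tdown_le_iff: "y \<in> Rep_tensor I \<Longrightarrow> tdown y \<le> I"
  using tideal_down[OF tideal_Rep] by (auto simp: less_eq_tensor.rep_eq tdown.rep_eq)

lemma tdown_mono: "tle x y \<Longrightarrow> tdown x \<le> tdown y"
  by transfer (auto intro: tprec_tle_trans)

lemma tdown_approx:
  fixes I :: "'a::cu_semigroup \<otimes> 'b::cu_semigroup"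
  obtains w where "\<And>n. tprec (w n) (w (Suc n))" "\<And>n. w n \<in> Rep_tensor I"
    "incseq (\<lambda>n. tdown (w n))" "is_lub (range (\<lambda>n. tdown (w n))) I"
proof -
  obtain w where w: "\<And>n. tprec (w n) (w (Suc n))" "\<And>n. w n \<in> Rep_tensor I"
    "\<And>x. x \<in> Rep_tensor I \<Longrightarrow> \<exists>n. tprec x (w n)"
    by (rule tideal_seqE[OF tideal_Rep[of I]]) blast
  have inc: "incseq (\<lambda>n. tdown (w n))"
    by (intro incseq_SucI tdown_mono tprec_imp_tle w(1))
  have "Rep_tensor I = (\<Union>n. Rep_tensor (tdown (w n)))"
    using w(3) tideal_down[OF tideal_Rep _ w(2)] by (auto simp: tdown.rep_eq)
  with inc have "is_lub (range (\<lambda>n. tdown (w n))) I" by (simp add: tensor_lub_iff)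
  with w inc show ?thesis using that[of w] by blast
qed

lemma tensor_way_below_iff:
  fixes I J :: "'a::cu_semigroup \<otimes> 'b::cu_semigroup"
  shows "I \<lless> J \<longleftrightarrow> (\<exists>y\<in>Rep_tensor J. I \<le> tdown y)"
proof
  assume IJ: "I \<lless> J"
  obtain w where w: "\<And>n. w n \<in> Rep_tensor J"
    "incseq (\<lambda>n. tdown (w n))" "is_lub (range (\<lambda>n. tdown (w n))) J"
    using tdown_approx[of J] by metis
  from way_belowD[OF IJ w(2,3)] w(1) show "\<exists>y\<in>Rep_tensor J. I \<le> tdown y" by auto
next
  assume "\<exists>y\<in>Rep_tensor J. I \<le> tdown y"
  then obtain y where y: "y \<in> Rep_tensor J" "I \<le> tdown y" by blast
  show "I \<lless> J"
    unfolding way_below_def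
  proof (intro allI impI)
    fix c :: "nat \<Rightarrow> 'a \<otimes> 'b" and s
    assume c: "incseq c" "is_lub (range c) s" "J \<le> s"
    then have "y \<in> (\<Union>n. Rep_tensor (c n))"
      using y(1) by (auto simp: tensor_lub_iff less_eq_tensor.rep_eq)
    then obtain k where "y \<in> Rep_tensor (c k)" by blast
    then have "tdown y \<le> c k" by (rule tdown_le_iff)
    with y(2) show "\<exists>k. I \<le> c k" by (blast intro: order.trans)
  qed
qed

lemma tdown_empty: "tdown {#} = 0"
  by transfer simp

lemma tdown_add: "tdown (x + y) = tdown x + tdown y"
proof -
  have "\<exists>u v. tprec u x \<and> tprec v y \<and> tprec z (u + v)" if z: "tprec z (x + y)" for z
  proof -
    obtain w where w: "tle z w" "twb w (x + y)" using z unfolding tprec_iff by blast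
    obtain w1 w2 where w': "w = w1 + w2" "twb w1 x" "twb w2 y" using w(2) by (rule twb_plusE)
    have "\<exists>u. tprec a u \<and> tprec u b" if "tprec a b" for a b :: "('a \<times> 'b) multiset"
      using tideal_round[OF tideal_tprec, of a b] that by blast
    with w' obtain u v where "tprec w1 u" "tprec u x" "tprec w2 v" "tprec v y"
      using twb_imp_tprec by meson
    with w(1) w'(1) show ?thesis using tle_tprec_trans tprec_add by blast
  qed
  moreover have "tprec z (x + y)" if "tprec u x" "tprec v y" "tprec z (u + v)" for z u v
    using tprec_trans[OF that(3) tprec_add[OF that(1,2)]] .
  ultimately have "z \<in> Rep_tensor (tdown (x + y)) \<longleftrightarrow> z \<in> Rep_tensor (tdown x + tdown y)" for z
    unfolding tdown.rep_eq plus_tensor.rep_eq mem_Collect_eq by blast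
  then show ?thesis by (metis Rep_tensor_inject subsetI subset_antisym)
qed

lemma mem_plus_tensorI:
  assumes "x \<in> Rep_tensor I" "y \<in> Rep_tensor J"
  shows "x + y \<in> Rep_tensor (I + J)"
proof -
  obtain x' where "x' \<in> Rep_tensor I" "tprec x x'" using tideal_round[OF tideal_Rep assms(1)] by blast
  moreover obtain y' where "y' \<in> Rep_tensor J" "tprec y y'" using tideal_round[OF tideal_Rep assms(2)] by blast
  ultimately show ?thesis by (auto simp: plus_tensor.rep_eq intro: tprec_add)
qed

lemma plus_tensor_mono: "I \<le> I' \<Longrightarrow> J \<le> J' \<Longrightarrow> I + J \<le> I' + (J' :: 'a::cu_semigroup \<otimes> 'b::cu_semigroup)"
  by transfer blast

lemma plus_tensor_lub:
  fixes c d :: "nat \<Rightarrow> 'a::cu_semigroup \<otimes> 'b::cu_semigroup"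
  assumes c: "incseq c" "is_lub (range c) s" and d: "incseq d" "is_lub (range d) t"
  shows "is_lub (range (\<lambda>n. c n + d n)) (s + t)"
proof -
  have inc: "incseq (\<lambda>n. c n + d n)" using c(1) d(1) by (auto simp: monotone_def intro: plus_tensor_mono)
  have s: "Rep_tensor s = (\<Union>n. Rep_tensor (c n))" and t: "Rep_tensor t = (\<Union>n. Rep_tensor (d n))"
    using c d tensor_lub_iff by blast+
  have "\<exists>n. \<exists>u\<in>Rep_tensor (c n). \<exists>v\<in>Rep_tensor (d n). tprec x (u + v)"
    if "u \<in> Rep_tensor (c k)" "v \<in> Rep_tensor (d l)" "tprec x (u + v)" for x u v k l
  proof -
    have "c k \<le> c (max k l)" "d l \<le> d (max k l)" using incseqD[OF c(1)] incseqD[OF d(1)] by auto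
    with that show ?thesis unfolding less_eq_tensor.rep_eq by blast
  qed
  then show ?thesis
    unfolding tensor_lub_iff[OF inc] plus_tensor.rep_eq s t by auto
qed

lemma tdown_induct_lub:
  fixes I :: "'a::cu_semigroup \<otimes> 'b::cu_semigroup"
  obtains w where "incseq (\<lambda>n. tdown (w n))" "is_lub (range (\<lambda>n. tdown (w n))) I"
  using tdown_approx[of I] by metis

instance tensor :: (cu_semigroup, cu_semigroup) cu_semigroup
proof
  fix I J K I' J' :: "'a \<otimes> 'b" and c d :: "nat \<Rightarrow> 'a \<otimes> 'b"
  show comm: "I + J = J + I" for I J :: "'a \<otimes> 'b"
  proof -
    have "(\<exists>u\<in>I. \<exists>v\<in>J. tprec x (u + v)) \<longleftrightarrow> (\<exists>u\<in>J. \<exists>v\<in>I. tprec x (u + v))"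
      for I J and x :: "('a \<times> 'b) multiset"
      by (metis union_commute)
    then show ?thesis by transfer simp
  qed
  obtain u where u: "incseq (\<lambda>n. tdown (u n))" "is_lub (range (\<lambda>n. tdown (u n))) I"
    by (rule tdown_induct_lub[of I]) blast
  obtain v where v: "incseq (\<lambda>n. tdown (v n))" "is_lub (range (\<lambda>n. tdown (v n))) J"
    by (rule tdown_induct_lub[of J]) blast
  obtain w where w: "incseq (\<lambda>n. tdown (w n))" "is_lub (range (\<lambda>n. tdown (w n))) K"
    by (rule tdown_induct_lub[of K]) blast
  have inc: "incseq (\<lambda>n. tdown (x n) + tdown (y n))"
    if "incseq (\<lambda>n. tdown (x n))" "incseq (\<lambda>n. tdown (y n))" for x y :: "nat \<Rightarrow> ('a \<times> 'b) multiset"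
    using that by (auto simp: monotone_def intro: plus_tensor_mono)
  show "I + J + K = I + (J + K)"
  proof (rule is_lub_unique)
    show "is_lub (range (\<lambda>n. tdown (u n) + tdown (v n) + tdown (w n))) (I + J + K)"
      by (intro plus_tensor_lub inc u v w)
    have "is_lub (range (\<lambda>n. tdown (u n) + (tdown (v n) + tdown (w n)))) (I + (J + K))"
      by (intro plus_tensor_lub inc u v w)
    then show "is_lub (range (\<lambda>n. tdown (u n) + tdown (v n) + tdown (w n))) (I + (J + K))"
      by (simp only: tdown_add[symmetric] union_assoc)
  qed
  show "0 + I = I"
  proof (rule is_lub_unique)
    have "is_lub (range (\<lambda>n. tdown {#} + tdown (u n))) (0 + I)"
      unfolding tdown_empty by (intro plus_tensor_lub u is_lub_const) (simp add: monotone_def)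
    then show "is_lub (range (\<lambda>n. tdown (u n))) (0 + I)"
      by (simp only: tdown_add[symmetric] empty_neutral)
  qed (rule u)
  show "K + I \<le> K + J" if "I \<le> J"
    using that by (intro plus_tensor_mono) auto
  show "0 \<le> I"
    unfolding tdown_empty[symmetric] by (rule tdown_le_iff) (rule tideal_empty[OF tideal_Rep])
  show "\<exists>s. is_lub (range c) s" if c: "incseq c"
  proof -
    have "tideal (\<Union>n. Rep_tensor (c n))"
      using incseqD[OF c] Rep_tensor by (intro tideal_Union) (auto simp: less_eq_tensor.rep_eq)
    then obtain t where t: "Rep_tensor t = (\<Union>n. Rep_tensor (c n))"
      by (metis Rep_tensor_cases mem_Collect_eq)
    then show ?thesis using tensor_lub_iff[OF c] by blast
  qed
  show "\<exists>c. (\<forall>n. c n \<lless> c (Suc n)) \<and> is_lub (range c) I"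
  proof -
    obtain w where w: "\<And>n. tprec (w n) (w (Suc n))" "is_lub (range (\<lambda>n. tdown (w n))) I"
      using tdown_approx[of I] by metis
    have "tdown (w n) \<lless> tdown (w (Suc n))" for n
      unfolding tensor_way_below_iff using w(1) by (auto simp: tdown.rep_eq)
    with w(2) show ?thesis by (intro exI[of _ "\<lambda>n. tdown (w n)"]) auto
  qed
  show "I' + J' \<lless> I + J" if IJ: "I' \<lless> I" "J' \<lless> J"
  proof -
    from IJ obtain x y where xy: "x \<in> Rep_tensor I" "I' \<le> tdown x" "y \<in> Rep_tensor J" "J' \<le> tdown y"
      unfolding tensor_way_below_iff by blast
    then have "x + y \<in> Rep_tensor (I + J)" "I' + J' \<le> tdown (x + y)"
      by (auto simp: tdown_add intro: mem_plus_tensorI plus_tensor_mono)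
    then show ?thesis unfolding tensor_way_below_iff by blast
  qed
  show "is_lub (range (\<lambda>n. c n + d n)) (I + J)"
    if "incseq c" "incseq d" "is_lub (range c) I" "is_lub (range d) J"
    by (rule plus_tensor_lub[OF that(1,3,2,4)])
qed

definition simple_tensor :: "'a::cu_semigroup \<Rightarrow> 'b::cu_semigroup \<Rightarrow> 'a \<otimes> 'b" (infixr "\<otimes>" 75) where
  "a \<otimes> b = tdown {#(a, b)#}"

lemma tdown_eqI: "tle x y \<Longrightarrow> tle y x \<Longrightarrow> tdown x = tdown y"
  by (intro order.antisym tdown_mono)

lemma simple_tensor_bimorphism:
  "cu_bimorphism ((\<otimes>) :: 'a::cu_semigroup \<Rightarrow> 'b::cu_semigroup \<Rightarrow> 'a \<otimes> 'b)"
  unfolding cu_bimorphism_def gen_cu_bimorphism_def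
proof (intro conjI allI impI)
  fix a a' :: 'a and b b' :: 'b and c :: "nat \<Rightarrow> 'a" and d :: "nat \<Rightarrow> 'b"
  show "a \<otimes> 0 = (0 :: 'a \<otimes> 'b)" "0 \<otimes> b = (0 :: 'a \<otimes> 'b)"
    unfolding simple_tensor_def tdown_empty[symmetric]
    by (intro tdown_eqI tle.zero_left tle.zero_right tle.least)+
  show "(a + a') \<otimes> b = a \<otimes> b + a' \<otimes> b" "a \<otimes> (b + b') = a \<otimes> b + a \<otimes> b'"
    unfolding simple_tensor_def tdown_add[symmetric]
    using tle.split_left[of a a' b] tle.merge_left[of a b a'] tle.split_right[of a b b'] tle.merge_right[of a b b']
    by (auto intro!: tdown_eqI simp: add_mset_commute)
  show "a \<otimes> b \<le> a' \<otimes> b" if "a \<le> a'"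
    unfolding simple_tensor_def using that by (intro tdown_mono tle.mono) auto
  show "a \<otimes> b \<le> a \<otimes> b'" if "b \<le> b'"
    unfolding simple_tensor_def using that by (intro tdown_mono tle.mono) auto
  show "a' \<otimes> b' \<lless> a \<otimes> b" if "a' \<lless> a" "b' \<lless> b"
    unfolding tensor_way_below_iff simple_tensor_def
  proof
    show "{#(a', b')#} \<in> Rep_tensor (tdown {#(a, b)#})"
      using that by (auto simp: tdown.rep_eq intro!: twb_imp_tprec twb_add_mset)
  qed simp
  show "is_lub (range (\<lambda>k. c k \<otimes> d k)) (a \<otimes> b)"
    if c: "incseq c" "is_lub (range c) a" and d: "incseq d" "is_lub (range d) b"
  proof -
    have inc: "incseq (\<lambda>k. c k \<otimes> d k)"
      unfolding simple_tensor_def using c(1) d(1)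
      by (auto simp: monotone_def intro!: tdown_mono tle.mono)
    have "\<exists>k. tprec x {#(c k, d k)#}" if x: "tprec x {#(a, b)#}" for x
    proof -
      obtain w where w: "tle x w" "twb w {#(a, b)#}" using x unfolding tprec_iff by blast
      obtain p q where pq: "w = {#(p, q)#}" "p \<lless> a" "q \<lless> b" using w(2) by (rule twb_singleE)
      obtain p' where p': "p \<lless> p'" "p' \<lless> a" using way_below_interp[OF pq(2) pq(2)] .
      obtain q' where q': "q \<lless> q'" "q' \<lless> b" using way_below_interp[OF pq(3) pq(3)] .
      obtain k where k: "p' \<le> c k" using way_below_approx[OF p'(2) c] .
      obtain l where l: "q' \<le> d l" using way_below_approx[OF q'(2) d] .
      have "p' \<le> c (max k l)" "q' \<le> d (max k l)"
        using k l incseqD[OF c(1), of k "max k l"] incseqD[OF d(1), of l "max k l"]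
        by (auto intro: order.trans)
      then have "twb w {#(c (max k l), d (max k l))#}"
        unfolding pq(1) using p'(1) q'(1) by (auto intro!: twb_add_mset intro: way_below_le_trans)
      with w(1) show ?thesis unfolding tprec_iff by blast
    qed
    moreover have "tprec x {#(a, b)#}" if "tprec x {#(c k, d k)#}" for x k
      using that by (rule tprec_tle_trans) (intro tle.mono is_lub_upper[OF c(2)] is_lub_upper[OF d(2)]; simp)
    ultimately show ?thesis
      unfolding tensor_lub_iff[OF inc] unfolding simple_tensor_def tdown.rep_eq by blast
  qed
qed

definition teval :: "('a \<Rightarrow> 'b \<Rightarrow> 'c::cu_semigroup) \<Rightarrow> ('a \<times> 'b) multiset \<Rightarrow> 'c" where
  "teval \<phi> x = (\<Sum>(a, b)\<in>#x. \<phi> a b)"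

lemma teval_simps [simp]:
  "teval \<phi> {#} = 0" "teval \<phi> (add_mset (a, b) x) = \<phi> a b + teval \<phi> x" "teval \<phi> (x + y) = teval \<phi> x + teval \<phi> y"
  by (simp_all add: teval_def)

lemma tdown_eq_teval: "tdown y = teval (\<otimes>) y"
proof (induction y)
  case (add p y)
  then show ?case using tdown_add[of "{#p#}" y] by (cases p) (simp add: simple_tensor_def)
qed (simp add: tdown_empty)

lemma gen_cu_morphism_teval:
  assumes "gen_cu_morphism h" shows "h (tdown y) = teval (\<lambda>a b. h (a \<otimes> b)) y"
  unfolding tdown_eq_teval using assms by (induction y) (auto simp: gen_cu_morphism_def)

lemma tensor_gen_morphism_le:
  fixes \<alpha> \<beta> :: "'a::cu_semigroup \<otimes> 'b::cu_semigroup \<Rightarrow> 'c::cu_semigroup"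
  assumes "gen_cu_morphism \<alpha>" "gen_cu_morphism \<beta>" "\<And>a b. \<alpha> (a \<otimes> b) \<le> \<beta> (a \<otimes> b)"
  shows "\<alpha> x \<le> \<beta> x"
proof -
  obtain w where w: "incseq (\<lambda>n. tdown (w n))" "is_lub (range (\<lambda>n. tdown (w n))) x"
    by (rule tdown_induct_lub[of x]) blast
  have \<alpha>: "is_lub (range (\<lambda>n. \<alpha> (tdown (w n)))) (\<alpha> x)" and \<beta>: "is_lub (range (\<lambda>n. \<beta> (tdown (w n)))) (\<beta> x)"
    using assms(1,2) w unfolding gen_cu_morphism_def by blast+
  have *: "\<alpha> (tdown y) \<le> \<beta> (tdown y)" for y
    unfolding gen_cu_morphism_teval[OF assms(1)] gen_cu_morphism_teval[OF assms(2)]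
    by (induction y) (auto intro!: add_mono simp: assms(3))
  show ?thesis
  proof (rule is_lub_least[OF \<alpha>])
    fix z assume "z \<in> range (\<lambda>n. \<alpha> (tdown (w n)))"
    then obtain n where "z = \<alpha> (tdown (w n))" by blast
    also note *
    also have "\<beta> (tdown (w n)) \<le> \<beta> x" by (rule is_lub_upper[OF \<beta>]) simp
    finally show "z \<le> \<beta> x" .
  qed
qed

lemma tensor_gen_morphism_eq:
  fixes \<alpha> \<beta> :: "'a::cu_semigroup \<otimes> 'b::cu_semigroup \<Rightarrow> 'c::cu_semigroup"
  assumes "gen_cu_morphism \<alpha>" "gen_cu_morphism \<beta>" "\<And>a b. \<alpha> (a \<otimes> b) = \<beta> (a \<otimes> b)"
  shows "\<alpha> = \<beta>"
proof
  fix x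
  have "\<alpha> x \<le> \<beta> x" by (rule tensor_gen_morphism_le[OF assms(1,2)]) (simp add: assms(3))
  moreover have "\<beta> x \<le> \<alpha> x" by (rule tensor_gen_morphism_le[OF assms(2,1)]) (simp add: assms(3))
  ultimately show "\<alpha> x = \<beta> x" by (rule order.antisym)
qed

lemma
  assumes "gen_cu_bimorphism \<phi>"
  shows gen_bimorphism_zero_right: "\<phi> a 0 = 0"
    and gen_bimorphism_zero_left: "\<phi> 0 b = 0"
    and gen_bimorphism_add_left: "\<phi> (a + a') b = \<phi> a b + \<phi> a' b"
    and gen_bimorphism_add_right: "\<phi> a (b + b') = \<phi> a b + \<phi> a b'"
    and gen_bimorphism_mono_left: "a \<le> a' \<Longrightarrow> \<phi> a b \<le> \<phi> a' b"
    and gen_bimorphism_mono_right: "b \<le> b' \<Longrightarrow> \<phi> a b \<le> \<phi> a b'"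
    and gen_bimorphism_lub: "incseq c \<Longrightarrow> incseq d \<Longrightarrow> is_lub (range c) s \<Longrightarrow> is_lub (range d) t \<Longrightarrow>
      is_lub (range (\<lambda>k. \<phi> (c k) (d k))) (\<phi> s t)"
proof -
  note * = assms[unfolded gen_cu_bimorphism_def]
  show "\<phi> a 0 = 0"
    by (rule *[THEN conjunct1, rule_format])
  show "\<phi> 0 b = 0"
    by (rule *[THEN conjunct2, THEN conjunct1, rule_format])
  show "\<phi> (a + a') b = \<phi> a b + \<phi> a' b"
    by (rule *[THEN conjunct2, THEN conjunct2, THEN conjunct1, rule_format])
  show "\<phi> a (b + b') = \<phi> a b + \<phi> a b'"
    by (rule *[THEN conjunct2, THEN conjunct2, THEN conjunct2, THEN conjunct1, rule_format])
  show "\<phi> a b \<le> \<phi> a' b" if "a \<le> a'"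
    by (rule *[THEN conjunct2, THEN conjunct2, THEN conjunct2, THEN conjunct2, THEN conjunct1, rule_format, OF that])
  show "\<phi> a b \<le> \<phi> a b'" if "b \<le> b'"
    by (rule *[THEN conjunct2, THEN conjunct2, THEN conjunct2, THEN conjunct2, THEN conjunct2, THEN conjunct1, rule_format, OF that])
  show "is_lub (range (\<lambda>k. \<phi> (c k) (d k))) (\<phi> s t)"
    if "incseq c" "incseq d" "is_lub (range c) s" "is_lub (range d) t"
    by (rule *[THEN conjunct2, THEN conjunct2, THEN conjunct2, THEN conjunct2, THEN conjunct2, THEN conjunct2, rule_format, OF that])
qed

lemma gen_bimorphism_mono:
  assumes "gen_cu_bimorphism \<phi>" "a \<le> a'" "b \<le> b'" shows "\<phi> a b \<le> \<phi> a' b'"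
  using gen_bimorphism_mono_left[OF assms(1,2)] gen_bimorphism_mono_right[OF assms(1,3)]
  by (rule order.trans)

lemma gen_bimorphism_teval_mono:
  assumes "gen_cu_bimorphism \<phi>" "tle x y" shows "teval \<phi> x \<le> teval \<phi> y"
  using assms(2)
proof (induction rule: tle.induct)
  case (trans x y z)
  then show ?case by (metis order.trans)
next
  case (mono a a' b b')
  then show ?case by (simp add: gen_bimorphism_mono[OF assms(1)])
next
  case (least x)
  show ?case by (simp add: zero_least)
qed (simp_all add: add_mono gen_bimorphism_zero_right[OF assms(1)] gen_bimorphism_zero_left[OF assms(1)]
  gen_bimorphism_add_left[OF assms(1)] gen_bimorphism_add_right[OF assms(1)])

lemma gen_bimorphism_teval_approx:
  assumes "gen_cu_bimorphism \<phi>"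
  shows "\<exists>w::nat \<Rightarrow> _. (\<forall>n. twb (w n) y) \<and> incseq (\<lambda>n. teval \<phi> (w n)) \<and>
    is_lub (range (\<lambda>n. teval \<phi> (w n))) (teval \<phi> y)"
proof (induction y)
  case empty
  show ?case by (intro exI[of _ "\<lambda>_. {#}"]) (auto simp: monotone_def is_lub_def)
next
  case (add p y)
  obtain a b where p: "p = (a, b)" by (cases p)
  obtain w where w: "\<And>n. twb (w n) y" "incseq (\<lambda>n. teval \<phi> (w n))"
    "is_lub (range (\<lambda>n. teval \<phi> (w n))) (teval \<phi> y)"
    using add.IH by blast
  obtain c where c: "incseq c" "\<And>n. c n \<lless> a" "is_lub (range c) a"
    by (rule cu_approx[of a]) blast
  obtain d where d: "incseq d" "\<And>n. d n \<lless> b" "is_lub (range d) b"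
    by (rule cu_approx[of b]) blast
  have lub: "is_lub (range (\<lambda>n. \<phi> (c n) (d n))) (\<phi> a b)"
    by (rule gen_bimorphism_lub[OF assms c(1) d(1) c(3) d(3)])
  have inc: "incseq (\<lambda>n. \<phi> (c n) (d n))"
    using incseqD[OF c(1)] incseqD[OF d(1)] by (intro incseq_SucI gen_bimorphism_mono[OF assms]) auto
  have "is_lub (range (\<lambda>n. \<phi> (c n) (d n) + teval \<phi> (w n))) (\<phi> a b + teval \<phi> y)"
    by (rule O4[OF inc w(2) lub w(3)])
  moreover have "incseq (\<lambda>n. \<phi> (c n) (d n) + teval \<phi> (w n))"
    using inc w(2) by (auto simp: monotone_def intro: add_mono)
  ultimately show ?case
    unfolding p by (intro exI[of _ "\<lambda>n. add_mset (c n, d n) (w n)"]) (auto intro!: twb_add_mset c d w)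
qed

definition gen_tensor_lift :: "('a \<Rightarrow> 'b \<Rightarrow> 'c) \<Rightarrow> 'a::cu_semigroup \<otimes> 'b::cu_semigroup \<Rightarrow> 'c::cu_semigroup" where
  "gen_tensor_lift \<phi> I = the_lub (teval \<phi> ` Rep_tensor I)"

lemma teval_lub_seqI:
  fixes I :: "'a::cu_semigroup \<otimes> 'b::cu_semigroup"
  assumes \<phi>: "gen_cu_bimorphism \<phi>" and w: "\<And>n::nat. w n \<in> Rep_tensor I" "incseq (\<lambda>n. tdown (w n))" "is_lub (range (\<lambda>n. tdown (w n))) I"
  shows "is_lub (range (\<lambda>n. teval \<phi> (w n))) s \<longleftrightarrow> is_lub (teval \<phi> ` Rep_tensor I) s"
proof -
  have *: "\<exists>n. teval \<phi> x \<le> teval \<phi> (w n)" if x: "x \<in> Rep_tensor I" for x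
  proof -
    obtain n where "tprec x (w n)"
      using w(3) x unfolding tensor_lub_iff[OF w(2)] by (auto simp: tdown.rep_eq)
    then show ?thesis using gen_bimorphism_teval_mono[OF \<phi> tprec_imp_tle] by blast
  qed
  show ?thesis
    by (intro iffI; erule is_lub_cofinal) (use * w(1) in blast)+
qed

lemma teval_approx:
  fixes I :: "'a::cu_semigroup \<otimes> 'b::cu_semigroup"
  assumes \<phi>: "gen_cu_bimorphism \<phi>"
  obtains w where "\<And>n::nat. w n \<in> Rep_tensor I" "incseq (\<lambda>n. tdown (w n))" "is_lub (range (\<lambda>n. tdown (w n))) I"
    "incseq (\<lambda>n. teval \<phi> (w n))" "is_lub (range (\<lambda>n. teval \<phi> (w n))) (gen_tensor_lift \<phi> I)"
    "is_lub (teval \<phi> ` Rep_tensor I) (gen_tensor_lift \<phi> I)"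
proof -
  obtain w where w: "\<And>n. tprec (w n) (w (Suc n))" "\<And>n. w n \<in> Rep_tensor I"
    "incseq (\<lambda>n. tdown (w n))" "is_lub (range (\<lambda>n. tdown (w n))) I"
    by (rule tdown_approx[of I]) blast
  have inc: "incseq (\<lambda>n. teval \<phi> (w n))"
    using w(1) by (intro incseq_SucI gen_bimorphism_teval_mono[OF \<phi>] tprec_imp_tle)
  then obtain s where "is_lub (range (\<lambda>n. teval \<phi> (w n))) s" using O1 by blast
  moreover from this have "is_lub (teval \<phi> ` Rep_tensor I) s"
    using teval_lub_seqI[OF \<phi> w(2,3,4)] by blast
  moreover from this have "gen_tensor_lift \<phi> I = s"
    unfolding gen_tensor_lift_def by (rule the_lub_eqI)
  ultimately show ?thesis using that[OF w(2,3,4) inc] by simp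
qed

lemma gen_tensor_lift_lub:
  fixes I :: "'a::cu_semigroup \<otimes> 'b::cu_semigroup"
  assumes \<phi>: "gen_cu_bimorphism \<phi>"
  shows "is_lub (teval \<phi> ` Rep_tensor I) (gen_tensor_lift \<phi> I)"
  by (rule teval_approx[OF \<phi>, of I]) blast

lemma gen_tensor_lift_tdown:
  assumes \<phi>: "gen_cu_bimorphism \<phi>"
  shows "gen_tensor_lift \<phi> (tdown y) = teval \<phi> y"
  unfolding gen_tensor_lift_def
proof (rule the_lub_eqI, rule is_lubI)
  fix z assume "z \<in> teval \<phi> ` Rep_tensor (tdown y)"
  then show "z \<le> teval \<phi> y"
    by (auto simp: tdown.rep_eq intro: gen_bimorphism_teval_mono[OF \<phi>] tprec_imp_tle)
next
  fix u assume u: "\<And>z. z \<in> teval \<phi> ` Rep_tensor (tdown y) \<Longrightarrow> z \<le> u"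
  obtain w where w: "\<And>n::nat. twb (w n) y" "is_lub (range (\<lambda>n. teval \<phi> (w n))) (teval \<phi> y)"
    using gen_bimorphism_teval_approx[OF \<phi>, of y] by blast
  show "teval \<phi> y \<le> u"
    using u w(1) by (intro is_lub_least[OF w(2)]) (auto simp: tdown.rep_eq twb_imp_tprec)
qed

lemma gen_tensor_lift_morphism:
  fixes \<phi> :: "'a::cu_semigroup \<Rightarrow> 'b::cu_semigroup \<Rightarrow> 'c::cu_semigroup"
  assumes \<phi>: "gen_cu_bimorphism \<phi>"
  shows "gen_cu_morphism (gen_tensor_lift \<phi>)"
proof -
  have mono: "gen_tensor_lift \<phi> I \<le> gen_tensor_lift \<phi> J" if "I \<le> J" for I J
    using is_lub_upper[OF gen_tensor_lift_lub[OF \<phi>, of J]] that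
    by (intro is_lub_least[OF gen_tensor_lift_lub[OF \<phi>, of I]]) (auto simp: less_eq_tensor.rep_eq)
  have add: "gen_tensor_lift \<phi> (I + J) = gen_tensor_lift \<phi> I + gen_tensor_lift \<phi> J" for I J
  proof -
    obtain u where u: "\<And>n::nat. u n \<in> Rep_tensor I" "incseq (\<lambda>n. tdown (u n))" "is_lub (range (\<lambda>n. tdown (u n))) I"
      "incseq (\<lambda>n. teval \<phi> (u n))" "is_lub (range (\<lambda>n. teval \<phi> (u n))) (gen_tensor_lift \<phi> I)"
      by (rule teval_approx[OF \<phi>, of I]) blast
    obtain v where v: "\<And>n::nat. v n \<in> Rep_tensor J" "incseq (\<lambda>n. tdown (v n))" "is_lub (range (\<lambda>n. tdown (v n))) J"
      "incseq (\<lambda>n. teval \<phi> (v n))" "is_lub (range (\<lambda>n. teval \<phi> (v n))) (gen_tensor_lift \<phi> J)"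
      by (rule teval_approx[OF \<phi>, of J]) blast
    have "is_lub (range (\<lambda>n. tdown (u n) + tdown (v n))) (I + J)" by (rule plus_tensor_lub[OF u(2,3) v(2,3)])
    then have lub: "is_lub (range (\<lambda>n. tdown (u n + v n))) (I + J)" by (simp only: tdown_add)
    have "incseq (\<lambda>n. tdown (u n) + tdown (v n))"
      using u(2) v(2) by (auto simp: monotone_def intro: add_mono)
    then have inc: "incseq (\<lambda>n. tdown (u n + v n))" by (simp only: tdown_add)
    have "is_lub (range (\<lambda>n. teval \<phi> (u n) + teval \<phi> (v n))) (gen_tensor_lift \<phi> I + gen_tensor_lift \<phi> J)"
      by (rule O4[OF u(4) v(4) u(5) v(5)])
    then have "is_lub (range (\<lambda>n. teval \<phi> (u n + v n))) (gen_tensor_lift \<phi> I + gen_tensor_lift \<phi> J)"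
      by simp
    then have "is_lub (teval \<phi> ` Rep_tensor (I + J)) (gen_tensor_lift \<phi> I + gen_tensor_lift \<phi> J)"
      using teval_lub_seqI[OF \<phi> mem_plus_tensorI[OF u(1) v(1)] inc lub] by blast
    then show ?thesis using gen_tensor_lift_lub[OF \<phi>] is_lub_unique by blast
  qed
  have lub: "is_lub (range (\<lambda>n. gen_tensor_lift \<phi> (c n))) (gen_tensor_lift \<phi> s)"
    if c: "incseq c" "is_lub (range c) s" for c s
  proof (rule is_lubI)
    fix z assume "z \<in> range (\<lambda>n. gen_tensor_lift \<phi> (c n))"
    then show "z \<le> gen_tensor_lift \<phi> s" using is_lub_upper[OF c(2)] by (auto intro: mono)
  next
    fix u assume u: "\<And>z. z \<in> range (\<lambda>n. gen_tensor_lift \<phi> (c n)) \<Longrightarrow> z \<le> u"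
    show "gen_tensor_lift \<phi> s \<le> u"
    proof (rule is_lub_least[OF gen_tensor_lift_lub[OF \<phi>, of s]])
      fix z assume "z \<in> teval \<phi> ` Rep_tensor s"
      then obtain n x where x: "x \<in> Rep_tensor (c n)" "z = teval \<phi> x"
        using c(2) unfolding tensor_lub_iff[OF c(1)] by auto
      have "z \<le> gen_tensor_lift \<phi> (c n)"
        using x by (auto intro: is_lub_upper[OF gen_tensor_lift_lub[OF \<phi>]])
      also have "\<dots> \<le> u" using u by blast
      finally show "z \<le> u" .
    qed
  qed
  have "gen_tensor_lift \<phi> 0 = 0"
    using gen_tensor_lift_tdown[OF \<phi>, of "{#}"] by (simp add: tdown_empty)
  with mono add lub show ?thesis unfolding gen_cu_morphism_def by (auto intro!: monoI)
qed

lemma gen_tensor_lift_simple: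
  "gen_cu_bimorphism \<phi> \<Longrightarrow> gen_tensor_lift \<phi> (a \<otimes> b) = \<phi> a b"
  by (simp add: simple_tensor_def gen_tensor_lift_tdown)

theorem tensor_gen_universal:
  fixes \<phi> :: "'a::cu_semigroup \<Rightarrow> 'b::cu_semigroup \<Rightarrow> 'c::cu_semigroup"
  assumes "gen_cu_bimorphism \<phi>"
  shows "\<exists>!h. gen_cu_morphism h \<and> (\<forall>a b. h (a \<otimes> b) = \<phi> a b)"
proof (rule ex1I)
  show "gen_cu_morphism (gen_tensor_lift \<phi>) \<and> (\<forall>a b. gen_tensor_lift \<phi> (a \<otimes> b) = \<phi> a b)"
    using gen_tensor_lift_morphism[OF assms] gen_tensor_lift_simple[OF assms] by simp
  then show "h = gen_tensor_lift \<phi>" if "gen_cu_morphism h \<and> (\<forall>a b. h (a \<otimes> b) = \<phi> a b)" for h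
    using that by (intro tensor_gen_morphism_eq) auto
qed

lemma cu_bimorphism_teval:
  assumes \<phi>: "cu_bimorphism \<phi>" and "tprec x y" shows "teval \<phi> x \<lless> teval \<phi> y"
proof -
  obtain w where w: "tle x w" "twb w y" using assms(2) unfolding tprec_iff by blast
  have "teval \<phi> w \<lless> teval \<phi> y"
    using w(2)
  proof (induction y arbitrary: w)
    case empty
    then show ?case by (simp add: zero_way_below)
  next
    case (add p y)
    obtain a b where p: "p = (a, b)" by (cases p)
    from add.prems obtain a' b' w' where "w = add_mset (a', b') w'" "a' \<lless> a" "b' \<lless> b" "twb w' y"
      unfolding p by (rule twb_add_msetE)
    with add.IH \<phi> show ?case by (auto simp: p cu_bimorphism_def intro: O3)
  qed
  with gen_bimorphism_teval_mono[OF _ w(1)] \<phi> show ?thesis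
    unfolding cu_bimorphism_def by (blast intro: le_way_below_trans)
qed

theorem tensor_universal:
  fixes \<phi> :: "'a::cu_semigroup \<Rightarrow> 'b::cu_semigroup \<Rightarrow> 'c::cu_semigroup"
  assumes \<phi>: "cu_bimorphism \<phi>"
  shows "\<exists>!h. cu_morphism h \<and> (\<forall>a b. h (a \<otimes> b) = \<phi> a b)"
proof (rule ex1I)
  have \<phi>': "gen_cu_bimorphism \<phi>" using \<phi> by (simp add: cu_bimorphism_def)
  have "gen_tensor_lift \<phi> I \<lless> gen_tensor_lift \<phi> J" if IJ: "I \<lless> J" for I J
  proof -
    obtain y where y: "y \<in> Rep_tensor J" "I \<le> tdown y" using IJ unfolding tensor_way_below_iff by blast
    obtain z where z: "z \<in> Rep_tensor J" "tprec y z" using tideal_round[OF tideal_Rep y(1)] by blast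
    have "gen_tensor_lift \<phi> I \<le> gen_tensor_lift \<phi> (tdown y)"
      using y(2) gen_tensor_lift_morphism[OF \<phi>'] by (auto simp: gen_cu_morphism_def dest: monoD)
    also have "\<dots> = teval \<phi> y" by (rule gen_tensor_lift_tdown[OF \<phi>'])
    finally have "gen_tensor_lift \<phi> I \<lless> teval \<phi> z"
      using cu_bimorphism_teval[OF \<phi> z(2)] by (rule le_way_below_trans)
    then show ?thesis
      using is_lub_upper[OF gen_tensor_lift_lub[OF \<phi>', of J]] z(1) by (blast intro: way_below_le_trans)
  qed
  then show *: "cu_morphism (gen_tensor_lift \<phi>) \<and> (\<forall>a b. gen_tensor_lift \<phi> (a \<otimes> b) = \<phi> a b)"
    using gen_tensor_lift_morphism[OF \<phi>'] gen_tensor_lift_simple[OF \<phi>'] by (simp add: cu_morphism_def)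
  show "h = gen_tensor_lift \<phi>" if "cu_morphism h \<and> (\<forall>a b. h (a \<otimes> b) = \<phi> a b)" for h
    using that * by (intro tensor_gen_morphism_eq) (auto simp: cu_morphism_def)
qed

theorem tensor_morphism_le_iff:
  fixes \<alpha> \<beta> :: "'a::cu_semigroup \<otimes> 'b::cu_semigroup \<Rightarrow> 'c::cu_semigroup"
  assumes "cu_morphism \<alpha>" "cu_morphism \<beta>"
  shows "\<alpha> \<le> \<beta> \<longleftrightarrow> (\<forall>a b. \<alpha> (a \<otimes> b) \<le> \<beta> (a \<otimes> b))"
  using assms tensor_gen_morphism_le[of \<alpha> \<beta>] by (auto simp: le_fun_def cu_morphism_def)

definition tensor_map ::
  "('a::cu_semigroup \<Rightarrow> 'c::cu_semigroup) \<Rightarrow> ('b::cu_semigroup \<Rightarrow> 'd::cu_semigroup) \<Rightarrow> 'a \<otimes> 'b \<Rightarrow> 'c \<otimes> 'd"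
  where "tensor_map f g = (THE h. gen_cu_morphism h \<and> (\<forall>a b. h (a \<otimes> b) = f a \<otimes> g b))"

lemma gen_cu_bimorphism_tensor_map:
  fixes f :: "'a::cu_semigroup \<Rightarrow> 'c::cu_semigroup" and g :: "'b::cu_semigroup \<Rightarrow> 'd::cu_semigroup"
  assumes f: "gen_cu_morphism f" and g: "gen_cu_morphism g"
  shows "gen_cu_bimorphism (\<lambda>a b. f a \<otimes> g b)"
proof -
  have "gen_cu_bimorphism ((\<otimes>) :: 'c \<Rightarrow> 'd \<Rightarrow> _)"
    using simple_tensor_bimorphism by (auto simp: cu_bimorphism_def)
  moreover have "incseq (\<lambda>k. f (c k))" if "incseq c" for c
    using f that by (auto simp: gen_cu_morphism_def monotone_def)
  moreover have "incseq (\<lambda>k. g (c k))" if "incseq c" for c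
    using g that by (auto simp: gen_cu_morphism_def monotone_def)
  ultimately show ?thesis
    using f g unfolding gen_cu_bimorphism_def gen_cu_morphism_def
    by (intro conjI allI impI) (simp_all add: monoD)
qed

lemma
  fixes f :: "'a::cu_semigroup \<Rightarrow> 'c::cu_semigroup" and g :: "'b::cu_semigroup \<Rightarrow> 'd::cu_semigroup"
  assumes f: "gen_cu_morphism f" and g: "gen_cu_morphism g"
  shows gen_cu_morphism_tensor_map: "gen_cu_morphism (tensor_map f g)"
    and tensor_map_simple: "tensor_map f g (a \<otimes> b) = f a \<otimes> g b"
  using theI'[OF tensor_gen_universal[OF gen_cu_bimorphism_tensor_map[OF f g]]]
  unfolding tensor_map_def by simp_all

lemma cu_morphism_tensor_map:
  fixes f :: "'a::cu_semigroup \<Rightarrow> 'c::cu_semigroup" and g :: "'b::cu_semigroup \<Rightarrow> 'd::cu_semigroup"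
  assumes f: "cu_morphism f" and g: "cu_morphism g"
  shows "cu_morphism (tensor_map f g)"
proof -
  have fg: "gen_cu_morphism f" "gen_cu_morphism g" using f g by (auto simp: cu_morphism_def)
  have "gen_cu_bimorphism (\<lambda>a b. f a \<otimes> g b)" by (rule gen_cu_bimorphism_tensor_map[OF fg])
  then have "cu_bimorphism (\<lambda>a b. f a \<otimes> g b)"
    using f g simple_tensor_bimorphism[where 'a = 'c and 'b = 'd]
    unfolding cu_bimorphism_def cu_morphism_def by simp
  from ex1_implies_ex[OF tensor_universal[OF this]]
  obtain h where h: "cu_morphism h" "\<And>a b. h (a \<otimes> b) = f a \<otimes> g b"
    by (elim exE conjE) simp
  then have "tensor_map f g = h"
    using gen_cu_morphism_tensor_map[OF fg] tensor_map_simple[OF fg]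
    by (intro tensor_gen_morphism_eq) (auto simp: cu_morphism_def)
  with h(1) show ?thesis by simp
qed

section \<open>The internal hom\<close>

definition IQ :: "rat set" where
  "IQ = {0<..<1}"

definition mor_prec :: "('a::cu_semigroup \<Rightarrow> 'b::cu_semigroup) \<Rightarrow> ('a \<Rightarrow> 'b) \<Rightarrow> bool" (infix "\<prec>" 50) where
  "f \<prec> g \<longleftrightarrow> (\<forall>a' a. a' \<lless> a \<longrightarrow> f a' \<lless> g a)"

text \<open>Families indexed by \<^const>\<open>IQ\<close> are represented by functions on all of \<^typ>\<open>rat\<close>;
  no condition is imposed, and nothing depends, on their values outside \<^const>\<open>IQ\<close>.\<close>

definition cu_path :: "(rat \<Rightarrow> 'a::cu_semigroup \<Rightarrow> 'b::cu_semigroup) \<Rightarrow> bool" where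
  "cu_path f \<longleftrightarrow>
     (\<forall>l\<in>IQ. gen_cu_morphism (f l)) \<and> (\<forall>l'\<in>IQ. \<forall>l\<in>IQ. l' < l \<longrightarrow> f l' \<prec> f l)"

definition path_le ::
  "(rat \<Rightarrow> 'a::cu_semigroup \<Rightarrow> 'b::cu_semigroup) \<Rightarrow> (rat \<Rightarrow> 'a \<Rightarrow> 'b) \<Rightarrow> bool" (infix "\<lesssim>" 50) where
  "f \<lesssim> g \<longleftrightarrow> (\<forall>l\<in>IQ. \<exists>m\<in>IQ. f l \<prec> g m)"

definition path_equiv ::
  "(rat \<Rightarrow> 'a::cu_semigroup \<Rightarrow> 'b::cu_semigroup) \<Rightarrow> (rat \<Rightarrow> 'a \<Rightarrow> 'b) \<Rightarrow> bool" where
  "path_equiv f g \<longleftrightarrow> cu_path f \<and> cu_path g \<and> f \<lesssim> g \<and> g \<lesssim> f"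

lemma prec_imp_le:
  assumes "gen_cu_morphism f" "f \<prec> g" shows "f a \<le> g a"
proof -
  obtain c where c: "incseq c" "\<And>n. c n \<lless> a" "is_lub (range c) a"
    by (rule cu_approx[of a]) blast
  have "is_lub (range (\<lambda>n. f (c n))) (f a)"
    using assms(1) c(1,3) by (simp add: gen_cu_morphism_def)
  then show ?thesis
  proof (rule is_lub_least)
    fix z assume "z \<in> range (\<lambda>n. f (c n))"
    then show "z \<le> g a" using assms(2) c(2) way_below_imp_le unfolding mor_prec_def by blast
  qed
qed

lemma prec_trans: "f \<prec> g \<Longrightarrow> g \<prec> h \<Longrightarrow> f \<prec> h"
  unfolding mor_prec_def by (metis way_below_interp way_below_trans)

lemma prec_add:
  assumes "f \<prec> f'" "g \<prec> g'" shows "(\<lambda>a. f a + g a) \<prec> (\<lambda>a. f' a + g' a)"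
  using assms unfolding mor_prec_def by (simp add: O3)

lemma cu_path_morphism: "cu_path f \<Longrightarrow> l \<in> IQ \<Longrightarrow> gen_cu_morphism (f l)"
  by (simp add: cu_path_def)

lemma cu_path_prec: "cu_path f \<Longrightarrow> l' \<in> IQ \<Longrightarrow> l \<in> IQ \<Longrightarrow> l' < l \<Longrightarrow> f l' \<prec> f l"
  by (simp add: cu_path_def)

lemma IQ_gt: "l \<in> IQ \<Longrightarrow> \<exists>m\<in>IQ. l < m"
  using dense[of l 1] by (auto simp: IQ_def)

lemma IQ_max: "l \<in> IQ \<Longrightarrow> m \<in> IQ \<Longrightarrow> max l m \<in> IQ"
  by (simp add: max_def)

lemma IQ_mult: "l \<in> IQ \<Longrightarrow> m \<in> IQ \<Longrightarrow> l * m \<in> IQ \<and> l * m < l"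
  using mult_strict_left_mono[of m 1 l] less_trans[of "l * m" l 1] by (auto simp: IQ_def)

lemma path_le_refl: "cu_path f \<Longrightarrow> f \<lesssim> f"
  unfolding path_le_def using IQ_gt cu_path_prec by metis

lemma path_le_trans: "f \<lesssim> g \<Longrightarrow> g \<lesssim> h \<Longrightarrow> f \<lesssim> h"
  unfolding path_le_def using prec_trans by metis

lemma prec_path_mono:
  assumes "cu_path g" "f \<prec> g m" "m \<in> IQ" "m' \<in> IQ" "m \<le> m'" shows "f \<prec> g m'"
  using assms cu_path_prec[of g m m'] prec_trans by (cases "m = m'") fastforce+

lemma cu_path_zero: "cu_path (\<lambda>_ _. 0)"
  by (auto simp: cu_path_def gen_cu_morphism_def mor_prec_def zero_way_below is_lub_def monotone_def)

lemma gen_cu_morphism_add: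
  fixes f g :: "'a::cu_semigroup \<Rightarrow> 'b::cu_semigroup"
  assumes "gen_cu_morphism f" "gen_cu_morphism g"
  shows "gen_cu_morphism (\<lambda>a. f a + g a)"
  unfolding gen_cu_morphism_def
proof (intro conjI allI impI)
  show "f 0 + g 0 = 0" using assms by (simp add: gen_cu_morphism_def)
  show "f (a + b) + g (a + b) = f a + g a + (f b + g b)" for a b
    using assms by (simp add: gen_cu_morphism_def ac_simps)
  have mono: "mono f" "mono g" using assms by (simp_all add: gen_cu_morphism_def)
  then show "mono (\<lambda>a. f a + g a)" by (simp add: monotone_def add_mono)
  fix c :: "nat \<Rightarrow> 'a" and s assume c: "incseq c" "is_lub (range c) s"
  show "is_lub (range (\<lambda>n. f (c n) + g (c n))) (f s + g s)"
  proof (rule O4)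
    show "incseq (\<lambda>n. f (c n))" "incseq (\<lambda>n. g (c n))"
      using mono c(1) by (simp_all add: monotone_def)
    show "is_lub (range (\<lambda>n. f (c n))) (f s)" "is_lub (range (\<lambda>n. g (c n))) (g s)"
      using assms c by (simp_all add: gen_cu_morphism_def)
  qed
qed

lemma cu_path_add: "cu_path f \<Longrightarrow> cu_path g \<Longrightarrow> cu_path (\<lambda>l a. f l a + g l a)"
  by (simp add: cu_path_def gen_cu_morphism_add prec_add)

lemma path_le_add:
  assumes "cu_path f'" "cu_path g'" "f \<lesssim> f'" "g \<lesssim> g'"
  shows "(\<lambda>l a. f l a + g l a) \<lesssim> (\<lambda>l a. f' l a + g' l a)"
  unfolding path_le_def
proof
  fix l assume l: "l \<in> IQ"
  obtain m where m: "m \<in> IQ" "f l \<prec> f' m" using assms(3) l unfolding path_le_def by blast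
  obtain n where n: "n \<in> IQ" "g l \<prec> g' n" using assms(4) l unfolding path_le_def by blast
  note mn = IQ_max[OF m(1) n(1)]
  have "f l \<prec> f' (max m n)" by (rule prec_path_mono[OF assms(1) m(2,1) mn]) simp
  moreover have "g l \<prec> g' (max m n)" by (rule prec_path_mono[OF assms(2) n(2,1) mn]) simp
  ultimately show "\<exists>m\<in>IQ. (\<lambda>a. f l a + g l a) \<prec> (\<lambda>a. f' m a + g' m a)"
    using mn prec_add by blast
qed

lemma part_equivp_path_equiv: "part_equivp path_equiv"
proof (rule part_equivpI)
  show "\<exists>f. path_equiv f f"
    using cu_path_zero path_le_refl[OF cu_path_zero] unfolding path_equiv_def by blast
  show "symp path_equiv" by (simp add: symp_def path_equiv_def)
  show "transp path_equiv" unfolding transp_def path_equiv_def using path_le_trans by metis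
qed

quotient_type (overloaded) ('a, 'b) ihom = "rat \<Rightarrow> 'a::cu_semigroup \<Rightarrow> 'b::cu_semigroup" / partial: path_equiv
  by (rule part_equivp_path_equiv)

lemma path_equiv_refl: "path_equiv f f \<longleftrightarrow> cu_path f"
  using path_le_refl by (auto simp: path_equiv_def)

instantiation ihom :: (cu_semigroup, cu_semigroup) "{ord, plus, zero}"
begin

lift_definition less_eq_ihom :: "('a, 'b) ihom \<Rightarrow> ('a, 'b) ihom \<Rightarrow> bool" is "(\<lesssim>)"
  unfolding path_equiv_def using path_le_trans by metis

definition less_ihom :: "('a, 'b) ihom \<Rightarrow> ('a, 'b) ihom \<Rightarrow> bool" where
  "less_ihom x y \<longleftrightarrow> x \<le> y \<and> \<not> y \<le> x"

lift_definition zero_ihom :: "('a, 'b) ihom" is "\<lambda>_ _. 0"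
  by (simp add: path_equiv_refl cu_path_zero)

lift_definition plus_ihom :: "('a, 'b) ihom \<Rightarrow> ('a, 'b) ihom \<Rightarrow> ('a, 'b) ihom"
  is "\<lambda>f g l a. f l a + g l a"
  by (simp add: path_equiv_def cu_path_add path_le_add)

instance ..

end

lemma ihom_cases:
  fixes x :: "('a::cu_semigroup, 'b::cu_semigroup) ihom"
  obtains f where "cu_path f" "x = abs_ihom f"
  using Quotient3_abs_rep[OF Quotient3_ihom, of x] Quotient3_rep_reflp[OF Quotient3_ihom, of x]
  by (metis path_equiv_refl)

lemma abs_ihom_le_iff: "cu_path f \<Longrightarrow> cu_path g \<Longrightarrow> abs_ihom f \<le> abs_ihom g \<longleftrightarrow> f \<lesssim> g"
  by (simp add: less_eq_ihom.abs_eq path_equiv_refl)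

lemma abs_ihom_eq_iff: "cu_path f \<Longrightarrow> cu_path g \<Longrightarrow> abs_ihom f = abs_ihom g \<longleftrightarrow> f \<lesssim> g \<and> g \<lesssim> f"
  using Quotient3_rel[OF Quotient3_ihom, of f g] by (simp add: path_equiv_refl path_equiv_def[of f g])

lemma abs_ihom_add: "cu_path f \<Longrightarrow> cu_path g \<Longrightarrow> abs_ihom f + abs_ihom g = abs_ihom (\<lambda>l a. f l a + g l a)"
  by (simp add: plus_ihom.abs_eq path_equiv_refl)

instance ihom :: (cu_semigroup, cu_semigroup) order
proof
  fix x y z :: "('a, 'b) ihom"
  obtain f where f: "cu_path f" "x = abs_ihom f" by (rule ihom_cases)
  obtain g where g: "cu_path g" "y = abs_ihom g" by (rule ihom_cases)
  obtain h where h: "cu_path h" "z = abs_ihom h" by (rule ihom_cases)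
  show "x < y \<longleftrightarrow> x \<le> y \<and> \<not> y \<le> x" by (rule less_ihom_def)
  show "x \<le> x" using f by (simp add: abs_ihom_le_iff path_le_refl)
  show "x \<le> z" if "x \<le> y" "y \<le> z"
    using that f g h path_le_trans[of f g h] by (simp add: abs_ihom_le_iff)
  show "x = y" if "x \<le> y" "y \<le> x"
    using that f g by (simp add: abs_ihom_le_iff abs_ihom_eq_iff)
qed

lemma ihom_lubI:
  assumes F: "\<And>n::nat. cu_path (F n)" "cu_path h" "\<And>n. F n \<lesssim> h"
    "\<And>t. t \<in> IQ \<Longrightarrow> \<exists>n. \<exists>m\<in>IQ. h t \<prec> F n m"
  shows "is_lub (range (\<lambda>n. abs_ihom (F n))) (abs_ihom h)"
proof (rule is_lubI)
  fix x assume "x \<in> range (\<lambda>n. abs_ihom (F n))"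
  then show "x \<le> abs_ihom h" using F by (auto simp: abs_ihom_le_iff)
next
  fix u assume u: "\<And>x. x \<in> range (\<lambda>n. abs_ihom (F n)) \<Longrightarrow> x \<le> u"
  obtain g where g: "cu_path g" "u = abs_ihom g" by (rule ihom_cases)
  have Fg: "F n \<lesssim> g" for n
    using u[of "abs_ihom (F n)"] F(1) g by (simp add: abs_ihom_le_iff)
  have "h \<lesssim> g"
    unfolding path_le_def
  proof
    fix t assume "t \<in> IQ"
    then obtain n m where nm: "m \<in> IQ" "h t \<prec> F n m" using F(4) by blast
    then obtain k where "k \<in> IQ" "F n m \<prec> g k" using Fg[of n] unfolding path_le_def by blast
    with nm show "\<exists>k\<in>IQ. h t \<prec> g k" using prec_trans by blast
  qed
  then show "abs_ihom h \<le> u" using F(2) g by (simp add: abs_ihom_le_iff)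
qed

lemma ihom_lub_ex:
  assumes F: "\<And>n::nat. cu_path (F n)" "\<And>n. F n \<lesssim> F (Suc n)"
  obtains h where "cu_path h" "\<And>n. F n \<lesssim> h" "\<And>t. t \<in> IQ \<Longrightarrow> \<exists>n. \<exists>m\<in>IQ. h t \<prec> F n m"
proof -
  have Fmono: "F m \<lesssim> F n" if "m \<le> n" for m n
    using that by (induction rule: dec_induct) (use F path_le_refl path_le_trans in blast)+
  define r :: "nat \<Rightarrow> rat" where "r n = 1 - 1 / of_nat (n + 2)" for n
  have r: "r n \<in> IQ" for n by (simp add: r_def IQ_def)
  define mid where "mid l = (l + 1) / (2::rat)" for l
  have mid: "mid l \<in> IQ" "l < mid l" if "l \<in> IQ" for l using that by (auto simp: mid_def IQ_def)
  have step: "\<exists>l'. l' \<in> IQ \<and> (F n (mid l) \<prec> F (Suc n) l' \<and> (\<forall>k\<le>n. F k (r n) \<prec> F (Suc n) l'))"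
    if l: "l \<in> IQ" for l n
  proof -
    have "\<exists>v\<in>IQ. \<forall>k\<in>K. F k (r n) \<prec> F (Suc n) v" if "finite K" "K \<subseteq> {..n}" for K
      using that
    proof (induction K)
      case empty
      then show ?case using r by blast
    next
      case (insert k K)
      then obtain v where v: "v \<in> IQ" "\<forall>k\<in>K. F k (r n) \<prec> F (Suc n) v" by blast
      have "F k \<lesssim> F (Suc n)" using insert.prems by (intro Fmono) auto
      then obtain w where w: "w \<in> IQ" "F k (r n) \<prec> F (Suc n) w" using r[of n] unfolding path_le_def by blast
      have "F j (r n) \<prec> F (Suc n) (max v w)" if "j \<in> insert k K" for j
        using that v w prec_path_mono[OF F(1) _ v(1) IQ_max[OF v(1) w(1)], of "F j (r n)"]
          prec_path_mono[OF F(1) _ w(1) IQ_max[OF v(1) w(1)], of "F j (r n)"]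
        by (cases "j = k") auto
      then show ?case using IQ_max[OF v(1) w(1)] by blast
    qed
    from this[of "{..n}"] obtain v where v: "v \<in> IQ" "\<forall>k\<le>n. F k (r n) \<prec> F (Suc n) v" by auto
    obtain w where w: "w \<in> IQ" "F n (mid l) \<prec> F (Suc n) w"
      using F(2)[of n] mid(1)[OF l] unfolding path_le_def by blast
    have "F n (mid l) \<prec> F (Suc n) (max v w)"
      by (rule prec_path_mono[OF F(1) w(2,1) IQ_max[OF v(1) w(1)]]) simp
    moreover have "F k (r n) \<prec> F (Suc n) (max v w)" if "k \<le> n" for k
      by (rule prec_path_mono[OF F(1) v(2)[rule_format, OF that] v(1) IQ_max[OF v(1) w(1)]]) simp
    ultimately show ?thesis using IQ_max[OF v(1) w(1)] by blast
  qed
  have "\<exists>l. \<forall>n. l n \<in> IQ \<and> (F n (mid (l n)) \<prec> F (Suc n) (l (Suc n)) \<and> (\<forall>k\<le>n. F k (r n) \<prec> F (Suc n) (l (Suc n))))"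
    by (rule dependent_nat_choice) (use r step in blast)+
  then obtain l where l: "\<And>n. l n \<in> IQ" "\<And>n. F n (mid (l n)) \<prec> F (Suc n) (l (Suc n))"
    "\<And>n k. k \<le> n \<Longrightarrow> F k (r n) \<prec> F (Suc n) (l (Suc n))"
    by blast
  define p where "p u = l (nat \<lfloor>u\<rfloor>) + (mid (l (nat \<lfloor>u\<rfloor>)) - l (nat \<lfloor>u\<rfloor>)) * frac u" for u :: rat
  have p: "l (nat \<lfloor>u\<rfloor>) \<le> p u" "p u < mid (l (nat \<lfloor>u\<rfloor>))" "p u \<in> IQ" for u
  proof -
    let ?l = "l (nat \<lfloor>u\<rfloor>)"
    have m: "?l < mid ?l" "mid ?l \<in> IQ" "?l \<in> IQ" using mid l(1) by blast+
    have f: "0 \<le> frac u" "frac u < 1" by (simp_all add: frac_lt_1)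
    show 1: "?l \<le> p u" using m f by (simp add: p_def)
    have "(mid ?l - ?l) * frac u < (mid ?l - ?l) * 1" using m f by (intro mult_strict_left_mono) auto
    then show 2: "p u < mid ?l" by (simp add: p_def)
    show "p u \<in> IQ" using 1 2 m by (auto simp: IQ_def)
  qed
  define H where "H u = F (nat \<lfloor>u\<rfloor>) (p u)" for u
  have Hmid: "H u \<prec> F (nat \<lfloor>u\<rfloor>) (mid (l (nat \<lfloor>u\<rfloor>)))" for u
    unfolding H_def using p[of u] mid(1)[OF l(1)] by (intro cu_path_prec[OF F(1)])
  have chain: "F m (mid (l m)) \<prec> F n (l n)" if "m < n" for m n
    using that
  proof (induction rule: less_Suc_induct)
    case (2 i j k)
    have "F j (l j) \<prec> F j (mid (l j))" using mid l(1) by (intro cu_path_prec[OF F(1)]) blast+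
    with 2 show ?case using prec_trans by metis
  qed (rule l(2))
  have H: "H u \<prec> H v" if uv: "0 \<le> u" "u < v" for u v
  proof (cases "nat \<lfloor>u\<rfloor> = nat \<lfloor>v\<rfloor>")
    case True
    then have fl: "\<lfloor>u\<rfloor> = \<lfloor>v\<rfloor>" using uv floor_mono[of u v] by (simp add: eq_nat_nat_iff)
    then have "frac u < frac v" using uv by (simp add: frac_def)
    moreover have "l (nat \<lfloor>v\<rfloor>) < mid (l (nat \<lfloor>v\<rfloor>))" using mid l(1) by blast
    ultimately have "p u < p v" by (simp add: p_def fl)
    then show ?thesis unfolding H_def True using p(3) by (intro cu_path_prec[OF F(1)])
  next
    case False
    moreover have "nat \<lfloor>u\<rfloor> \<le> nat \<lfloor>v\<rfloor>" using uv by (intro nat_mono floor_mono) simp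
  ultimately have "nat \<lfloor>u\<rfloor> < nat \<lfloor>v\<rfloor>" by (simp only: le_neq_implies_less)
    then have "H u \<prec> F (nat \<lfloor>v\<rfloor>) (l (nat \<lfloor>v\<rfloor>))" using Hmid chain prec_trans by metis
    then show ?thesis
      unfolding H_def[of v] by (rule prec_path_mono[OF F(1) _ l(1) p(3) p(1)])
  qed
  define h where "h t = H (t / (1 - t))" for t
  show ?thesis
  proof
    show "cu_path h"
      unfolding cu_path_def
    proof (intro conjI ballI impI)
      fix t assume "t \<in> IQ"
      show "gen_cu_morphism (h t)" unfolding h_def H_def using p(3) by (intro cu_path_morphism[OF F(1)])
    next
      fix s t assume st: "s \<in> IQ" "t \<in> IQ" "s < t"
      then have "s / (1 - s) < t / (1 - t)" by (intro frac_less) (auto simp: IQ_def)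
      moreover have "0 \<le> s / (1 - s)" using st by (auto simp: IQ_def)
      ultimately show "h s \<prec> h t" unfolding h_def using H by blast
    qed
    show "F k \<lesssim> h" for k
      unfolding path_le_def
    proof
      fix x assume x: "x \<in> IQ"
      then have "0 < 1 - x" by (simp add: IQ_def)
      then obtain n0 where n0: "1 / of_nat (Suc n0) < 1 - x"
        using reals_Archimedean[of "1 - x"] by (auto simp: inverse_eq_divide)
      define n where "n = max k n0"
      have "1 / of_nat (n + 2) \<le> 1 / (of_nat (Suc n0) :: rat)" by (intro divide_left_mono) (auto simp: n_def)
      with n0 have "x < r n" by (simp add: r_def)
      then have "F k x \<prec> F k (r n)" using x r by (intro cu_path_prec[OF F(1)])
      then have "F k x \<prec> F (Suc n) (l (Suc n))" using l(3)[of k n] prec_trans by (auto simp: n_def)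
      moreover have "h (of_nat (Suc n) / of_nat (Suc (Suc n))) = F (Suc n) (l (Suc n))"
      proof -
        have "of_nat (Suc n) / of_nat (Suc (Suc n)) / (1 - of_nat (Suc n) / of_nat (Suc (Suc n))) = (of_nat (Suc n) :: rat)"
          by (simp add: field_simps)
        then have "h (of_nat (Suc n) / of_nat (Suc (Suc n))) = H (of_nat (Suc n))"
          unfolding h_def by (rule arg_cong)
        also have "\<dots> = F (Suc n) (l (Suc n))"
          unfolding H_def p_def frac_def by (simp only: floor_of_nat nat_int of_int_of_nat_eq) simp
        finally show ?thesis .
      qed
      moreover have "of_nat (Suc n) / of_nat (Suc (Suc n)) \<in> IQ" by (simp add: IQ_def)
      ultimately show "\<exists>m\<in>IQ. F k x \<prec> h m" by metis
    qed
    show "\<exists>n. \<exists>m\<in>IQ. h t \<prec> F n m" if "t \<in> IQ" for t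
      unfolding h_def using Hmid mid(1)[OF l(1)] by blast
  qed
qed

lemma ihom_lubD:
  assumes F: "\<And>n::nat. cu_path (F n)" "\<And>n. F n \<lesssim> F (Suc n)" and h: "cu_path h"
    and lub: "is_lub (range (\<lambda>n. abs_ihom (F n))) (abs_ihom h)" and t: "t \<in> IQ"
  shows "\<exists>n. \<exists>m\<in>IQ. h t \<prec> F n m"
proof -
  obtain h' where h': "cu_path h'" "\<And>n. F n \<lesssim> h'" "\<And>t. t \<in> IQ \<Longrightarrow> \<exists>n. \<exists>m\<in>IQ. h' t \<prec> F n m"
    using ihom_lub_ex[of F, OF F] by metis
  have "abs_ihom h = abs_ihom h'"
    by (rule is_lub_unique[OF lub ihom_lubI[of F, OF F(1) h']])
  then have "h \<lesssim> h'" using h h'(1) by (simp add: abs_ihom_eq_iff)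
  then obtain t' where "t' \<in> IQ" "h t \<prec> h' t'" using t unfolding path_le_def by blast
  with h'(3) show ?thesis using prec_trans by metis
qed

definition path_cut :: "(rat \<Rightarrow> 'a \<Rightarrow> 'b) \<Rightarrow> rat \<Rightarrow> rat \<Rightarrow> 'a \<Rightarrow> 'b" where
  "path_cut f l m = f (l * m)"

lemma cu_path_cut: "cu_path f \<Longrightarrow> l \<in> IQ \<Longrightarrow> cu_path (path_cut f l)"
  using IQ_mult by (auto simp: cu_path_def path_cut_def IQ_def)

lemma path_le_cutI:
  assumes "cu_path g" "l \<in> IQ" "k \<in> IQ" "k < l" "\<And>m. m \<in> IQ \<Longrightarrow> f m \<prec> g k"
  shows "f \<lesssim> path_cut g l"
  unfolding path_le_def
proof
  fix m assume "m \<in> IQ"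
  then have "f m \<prec> path_cut g l (k / l)" using assms by (simp add: path_cut_def IQ_def)
  moreover have "k / l \<in> IQ" using assms by (simp add: IQ_def)
  ultimately show "\<exists>m'\<in>IQ. f m \<prec> path_cut g l m'" by blast
qed

lemma path_cut_prec: "cu_path f \<Longrightarrow> l \<in> IQ \<Longrightarrow> m \<in> IQ \<Longrightarrow> path_cut f l m \<prec> f l"
  unfolding path_cut_def using IQ_mult[of l m] by (intro cu_path_prec) auto

lemma path_cut_mono: "cu_path f \<Longrightarrow> l \<in> IQ \<Longrightarrow> k \<in> IQ \<Longrightarrow> k < l \<Longrightarrow> path_cut f k \<lesssim> path_cut f l"
  by (rule path_le_cutI) (auto intro: path_cut_prec)

lemma path_cut_approx:
  assumes f: "cu_path f"
  obtains r :: "nat \<Rightarrow> rat" where "\<And>n. r n \<in> IQ" "\<And>n. r n < r (Suc n)"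
    "is_lub (range (\<lambda>n. abs_ihom (path_cut f (r n)))) (abs_ihom f)"
proof
  define r :: "nat \<Rightarrow> rat" where "r n = 1 - 1 / of_nat (n + 2)" for n
  show r: "r n \<in> IQ" for n by (simp add: r_def IQ_def)
  show rinc: "r n < r (Suc n)" for n by (simp add: r_def field_simps)
  show "is_lub (range (\<lambda>n. abs_ihom (path_cut f (r n)))) (abs_ihom f)"
  proof (rule ihom_lubI)
    show "path_cut f (r n) \<lesssim> f" for n
      unfolding path_le_def using path_cut_prec[OF f r] r by blast
    fix t assume t: "t \<in> IQ"
    then have "0 < 1 - t" by (simp add: IQ_def)
    then obtain n where n: "1 / of_nat (Suc n) < 1 - t"
      using reals_Archimedean[of "1 - t"] by (auto simp: inverse_eq_divide)
    have "1 / of_nat (n + 2) \<le> 1 / (of_nat (Suc n) :: rat)" by (intro divide_left_mono) auto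
    with n have tr: "t < r n" by (simp add: r_def)
    then obtain s where s: "t < s" "s < r n" using dense by blast
    then have sI: "s \<in> IQ" "s / r n \<in> IQ" using t r[of n] by (auto simp: IQ_def)
    have "f t \<prec> path_cut f (r n) (s / r n)"
      unfolding path_cut_def using r[of n] s t sI by (auto simp: IQ_def intro!: cu_path_prec[OF f])
    with sI show "\<exists>n. \<exists>m\<in>IQ. f t \<prec> path_cut f (r n) m" by blast
  qed (use f r cu_path_cut in blast)+
qed

lemma ihom_way_below_iff:
  assumes f: "cu_path f" and g: "cu_path g"
  shows "abs_ihom f \<lless> abs_ihom g \<longleftrightarrow> (\<exists>l\<in>IQ. f \<lesssim> path_cut g l)"
proof
  assume fg: "abs_ihom f \<lless> abs_ihom g"
  obtain r where r: "\<And>n. r n \<in> IQ" "\<And>n. r n < r (Suc n)"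
    "is_lub (range (\<lambda>n. abs_ihom (path_cut g (r n)))) (abs_ihom g)"
    using path_cut_approx[OF g] by metis
  have "incseq (\<lambda>n. abs_ihom (path_cut g (r n)))"
    using r(1,2) g by (intro incseq_SucI) (simp add: abs_ihom_le_iff cu_path_cut path_cut_mono)
  from way_belowD[OF fg this r(3) order.refl] obtain n where "abs_ihom f \<le> abs_ihom (path_cut g (r n))" ..
  then have "f \<lesssim> path_cut g (r n)" using f g r(1) by (simp add: abs_ihom_le_iff cu_path_cut)
  then show "\<exists>l\<in>IQ. f \<lesssim> path_cut g l" using r(1) by blast
next
  assume "\<exists>l\<in>IQ. f \<lesssim> path_cut g l"
  then obtain l where l: "l \<in> IQ" "f \<lesssim> path_cut g l" by blast
  show "abs_ihom f \<lless> abs_ihom g"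
    unfolding way_below_def
  proof (intro allI impI)
    fix c :: "nat \<Rightarrow> ('a, 'b) ihom" and s
    assume c: "incseq c" "is_lub (range c) s" "abs_ihom g \<le> s"
    have "\<exists>F. \<forall>n. cu_path (F n) \<and> c n = abs_ihom (F n)"
      by (intro choice allI) (metis ihom_cases)
    then obtain F where F: "\<And>n. cu_path (F n)" "c = (\<lambda>n. abs_ihom (F n))" by blast
    obtain h where h: "cu_path h" "s = abs_ihom h" by (rule ihom_cases)
    have Finc: "F n \<lesssim> F (Suc n)" for n using incseq_SucD[OF c(1), of n] F by (simp add: abs_ihom_le_iff)
    have "g \<lesssim> h" using c(3) g h by (simp add: abs_ihom_le_iff)
    then obtain t where t: "t \<in> IQ" "g l \<prec> h t" using l(1) unfolding path_le_def by blast
    obtain n m where nm: "m \<in> IQ" "h t \<prec> F n m"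
      using ihom_lubD[of F, OF F(1) Finc h(1) _ t(1)] c(2) F(2) h(2) by blast
    have "f \<lesssim> F n"
      unfolding path_le_def
    proof
      fix k assume "k \<in> IQ"
      then obtain k' where k': "k' \<in> IQ" "f k \<prec> path_cut g l k'" using l(2) unfolding path_le_def by blast
      have "f k \<prec> F n m"
        using prec_trans[OF prec_trans[OF k'(2) path_cut_prec[OF g l(1) k'(1)]] prec_trans[OF t(2) nm(2)]] .
      with nm(1) show "\<exists>m\<in>IQ. f k \<prec> F n m" by blast
    qed
    then show "\<exists>k. abs_ihom f \<le> c k" using f F by (auto simp: abs_ihom_le_iff)
  qed
qed

instance ihom :: (cu_semigroup, cu_semigroup) cu_semigroup
proof
  fix x y z x' y' :: "('a, 'b) ihom" and c d :: "nat \<Rightarrow> ('a, 'b) ihom"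
  obtain f where f: "cu_path f" "x = abs_ihom f" by (rule ihom_cases)
  obtain g where g: "cu_path g" "y = abs_ihom g" by (rule ihom_cases)
  obtain h where h: "cu_path h" "z = abs_ihom h" by (rule ihom_cases)
  have reps: "\<exists>F. (\<forall>n. cu_path (F n)) \<and> c = (\<lambda>n. abs_ihom (F n)) \<and> (\<forall>n. F n \<lesssim> F (Suc n))"
    if c: "incseq c" for c :: "nat \<Rightarrow> ('a, 'b) ihom"
  proof -
    have "\<exists>F. \<forall>n. cu_path (F n) \<and> c n = abs_ihom (F n)"
      by (intro choice allI) (metis ihom_cases)
    then obtain F where F: "\<And>n. cu_path (F n)" "c = (\<lambda>n. abs_ihom (F n))" by blast
    have "F n \<lesssim> F (Suc n)" for n using incseq_SucD[OF c, of n] F by (simp add: abs_ihom_le_iff)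
    with F show ?thesis by blast
  qed
  have zero: "0 = (abs_ihom (\<lambda>_ _. 0) :: ('a, 'b) ihom)" by (rule zero_ihom.abs_eq)
  show "x + y + z = x + (y + z)" "x + y = y + x"
    using f g h by (simp_all add: abs_ihom_add cu_path_add ac_simps)
  show "0 + x = x"
    using f by (simp add: zero abs_ihom_add cu_path_zero)
  show "z + x \<le> z + y" if "x \<le> y"
    using that f g h by (simp add: abs_ihom_add abs_ihom_le_iff cu_path_add path_le_add path_le_refl)
  show "0 \<le> x"
    unfolding zero f(2) abs_ihom_le_iff[OF cu_path_zero f(1)] path_le_def mor_prec_def
    using zero_way_below by blast
  show "\<exists>s. is_lub (range c) s" if c: "incseq c"
  proof -
    obtain F where F: "\<And>n. cu_path (F n)" "c = (\<lambda>n. abs_ihom (F n))" "\<And>n. F n \<lesssim> F (Suc n)"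
      using reps[OF c] by blast
    obtain h where "cu_path h" "\<And>n. F n \<lesssim> h" "\<And>t. t \<in> IQ \<Longrightarrow> \<exists>n. \<exists>m\<in>IQ. h t \<prec> F n m"
      using ihom_lub_ex[of F, OF F(1,3)] by metis
    from ihom_lubI[of F, OF F(1) this] F(2) show ?thesis by blast
  qed
  show "\<exists>c. (\<forall>n. c n \<lless> c (Suc n)) \<and> is_lub (range c) x"
  proof -
    obtain r where r: "\<And>n. r n \<in> IQ" "\<And>n. r n < r (Suc n)"
      "is_lub (range (\<lambda>n. abs_ihom (path_cut f (r n)))) (abs_ihom f)"
      using path_cut_approx[OF f(1)] by metis
    have "abs_ihom (path_cut f (r n)) \<lless> abs_ihom (path_cut f (r (Suc n)))" for n
    proof -
      have "r n / r (Suc n) \<in> IQ" "r (Suc n) \<noteq> 0"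
        using r(1)[of n] r(1)[of "Suc n"] r(2)[of n] by (auto simp: IQ_def)
      moreover from this have "path_cut (path_cut f (r (Suc n))) (r n / r (Suc n)) = path_cut f (r n)"
        by (intro ext) (simp add: path_cut_def)
      moreover have "path_cut f (r n) \<lesssim> path_cut f (r n)"
        by (rule path_le_refl[OF cu_path_cut[OF f(1) r(1)]])
      ultimately show ?thesis
        unfolding ihom_way_below_iff[OF cu_path_cut[OF f(1) r(1)] cu_path_cut[OF f(1) r(1)]] by metis
    qed
    with r(3) f(2) show ?thesis by (intro exI[of _ "\<lambda>n. abs_ihom (path_cut f (r n))"]) simp
  qed
  show "x' + y' \<lless> x + y" if wb: "x' \<lless> x" "y' \<lless> y"
  proof -
    obtain f' where f': "cu_path f'" "x' = abs_ihom f'" by (rule ihom_cases)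
    obtain g' where g': "cu_path g'" "y' = abs_ihom g'" by (rule ihom_cases)
    obtain l where l: "l \<in> IQ" "f' \<lesssim> path_cut f l" using wb(1) f f' ihom_way_below_iff by blast
    obtain m where m: "m \<in> IQ" "g' \<lesssim> path_cut g m" using wb(2) g g' ihom_way_below_iff by blast
    obtain k where k: "k \<in> IQ" "max l m < k" using IQ_gt[OF IQ_max[OF l(1) m(1)]] by blast
    have "f' \<lesssim> path_cut f k" by (rule path_le_trans[OF l(2) path_cut_mono[OF f(1) k(1) l(1)]]) (use k in simp)
    moreover have "g' \<lesssim> path_cut g k" by (rule path_le_trans[OF m(2) path_cut_mono[OF g(1) k(1) m(1)]]) (use k in simp)
    ultimately have "(\<lambda>l a. f' l a + g' l a) \<lesssim> (\<lambda>l a. path_cut f k l a + path_cut g k l a)"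
      by (intro path_le_add cu_path_cut f(1) g(1) k(1))
    also have "(\<lambda>l a. path_cut f k l a + path_cut g k l a) = path_cut (\<lambda>l a. f l a + g l a) k"
      by (simp add: path_cut_def fun_eq_iff)
    finally show ?thesis
      using k(1) f g f' g' by (auto simp: abs_ihom_add ihom_way_below_iff cu_path_add)
  qed
  show "is_lub (range (\<lambda>n. c n + d n)) (x + y)"
    if c: "incseq c" and d: "incseq d" and cx: "is_lub (range c) x" and dy: "is_lub (range d) y"
  proof -
    obtain F where F: "\<And>n. cu_path (F n)" "c = (\<lambda>n. abs_ihom (F n))" "\<And>n. F n \<lesssim> F (Suc n)"
      using reps[OF c] by blast
    obtain G where G: "\<And>n. cu_path (G n)" "d = (\<lambda>n. abs_ihom (G n))" "\<And>n. G n \<lesssim> G (Suc n)"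
      using reps[OF d] by blast
    have "is_lub (range (\<lambda>n. abs_ihom (\<lambda>l a. F n l a + G n l a))) (abs_ihom (\<lambda>l a. f l a + g l a))"
    proof (rule ihom_lubI)
      show "cu_path (\<lambda>l a. F n l a + G n l a)" for n by (rule cu_path_add[OF F(1) G(1)])
      show "cu_path (\<lambda>l a. f l a + g l a)" by (rule cu_path_add[OF f(1) g(1)])
      show "(\<lambda>l a. F n l a + G n l a) \<lesssim> (\<lambda>l a. f l a + g l a)" for n
      proof (rule path_le_add[OF f(1) g(1)])
        show "F n \<lesssim> f" using is_lub_upper[OF cx, of "c n"] F(1,2) f by (simp add: abs_ihom_le_iff)
        show "G n \<lesssim> g" using is_lub_upper[OF dy, of "d n"] G(1,2) g by (simp add: abs_ihom_le_iff)
      qed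
      fix t assume t: "t \<in> IQ"
      obtain n m where nm: "m \<in> IQ" "f t \<prec> F n m"
        using ihom_lubD[of F, OF F(1,3) f(1) _ t] cx F(2) f(2) by blast
      obtain n' m' where nm': "m' \<in> IQ" "g t \<prec> G n' m'"
        using ihom_lubD[of G, OF G(1,3) g(1) _ t] dy G(2) g(2) by blast
      have "F n \<lesssim> F (max n n')" using incseqD[OF c, of n "max n n'"] F(1,2) by (simp add: abs_ihom_le_iff)
      then obtain k where k: "k \<in> IQ" "f t \<prec> F (max n n') k"
        using nm prec_trans unfolding path_le_def by metis
      have "G n' \<lesssim> G (max n n')" using incseqD[OF d, of n' "max n n'"] G(1,2) by (simp add: abs_ihom_le_iff)
      then obtain k' where k': "k' \<in> IQ" "g t \<prec> G (max n n') k'"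
        using nm' prec_trans unfolding path_le_def by metis
      note kk = IQ_max[OF k(1) k'(1)]
      have "f t \<prec> F (max n n') (max k k')" by (rule prec_path_mono[OF F(1) k(2,1) kk]) simp
      moreover have "g t \<prec> G (max n n') (max k k')" by (rule prec_path_mono[OF G(1) k'(2,1) kk]) simp
      ultimately show "\<exists>n. \<exists>m\<in>IQ. (\<lambda>a. f t a + g t a) \<prec> (\<lambda>a. F n m a + G n m a)"
        using kk prec_add by blast
    qed
    then show ?thesis using f g F G by (simp add: abs_ihom_add)
  qed
qed

definition path_class :: "(rat \<Rightarrow> 'a::cu_semigroup \<Rightarrow> 'b::cu_semigroup) \<Rightarrow> ('a, 'b) ihom" where
  "path_class f = abs_ihom f"

lemma path_class_le_iff: "cu_path f \<Longrightarrow> cu_path g \<Longrightarrow> path_class f \<le> path_class g \<longleftrightarrow> f \<lesssim> g"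
  by (simp add: path_class_def abs_ihom_le_iff)

lemma path_class_eq_iff:
  "cu_path f \<Longrightarrow> cu_path g \<Longrightarrow> path_class f = path_class g \<longleftrightarrow> f \<lesssim> g \<and> g \<lesssim> f"
  by (simp add: path_class_def abs_ihom_eq_iff)

lemma path_class_add:
  "cu_path f \<Longrightarrow> cu_path g \<Longrightarrow> path_class f + path_class g = path_class (\<lambda>l a. f l a + g l a)"
  by (simp add: path_class_def abs_ihom_add)

lift_definition endpoint :: "('a::cu_semigroup, 'b::cu_semigroup) ihom \<Rightarrow> 'a \<Rightarrow> 'b"
  is "\<lambda>f a. the_lub ((\<lambda>l. f l a) ` IQ)"
proof
  fix f g :: "rat \<Rightarrow> 'a \<Rightarrow> 'b" and a
  assume fg: "path_equiv f g"
  have *: "\<exists>y\<in>(\<lambda>l. g l a) ` IQ. x \<le> y"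
    if "path_equiv f g" "x \<in> (\<lambda>l. f l a) ` IQ" for f g :: "rat \<Rightarrow> 'a \<Rightarrow> 'b" and x
  proof -
    from that(2) obtain l where l: "l \<in> IQ" "x = f l a" by blast
    with that(1) obtain m where "m \<in> IQ" "f l \<prec> g m" unfolding path_equiv_def path_le_def by blast
    moreover have "gen_cu_morphism (f l)" using that(1) l by (simp add: path_equiv_def cu_path_def)
    ultimately show ?thesis using l prec_imp_le by blast
  qed
  have "path_equiv g f" using fg by (simp add: path_equiv_def)
  note ** = *[OF fg] *[OF this]
  have "is_lub ((\<lambda>l. f l a) ` IQ) s \<longleftrightarrow> is_lub ((\<lambda>l. g l a) ` IQ) s" for s
    by (rule iffI; erule is_lub_cofinal; erule **)
  then show "the_lub ((\<lambda>l. f l a) ` IQ) = the_lub ((\<lambda>l. g l a) ` IQ)"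
    by (simp add: the_lub_def)
qed

lemma endpoint_path_class: "cu_path f \<Longrightarrow> endpoint (path_class f) a = the_lub ((\<lambda>l. f l a) ` IQ)"
  by (simp add: path_class_def endpoint.abs_eq path_equiv_refl)

section \<open>The evaluation map and the external tensor product\<close>

text \<open>\<open>tensor_lift \<phi>\<close> is the Cu-morphism induced by a Cu-bimorphism \<open>\<phi>\<close>, see
  \<open>tensor_universal\<close>.\<close>

definition tensor_lift ::
  "('a::cu_semigroup \<Rightarrow> 'b::cu_semigroup \<Rightarrow> 'c::cu_semigroup) \<Rightarrow> 'a \<otimes> 'b \<Rightarrow> 'c" where
  "tensor_lift \<phi> = (THE h. cu_morphism h \<and> (\<forall>a b. h (a \<otimes> b) = \<phi> a b))"

definition tensor_flip :: "'a::cu_semigroup \<otimes> 'b::cu_semigroup \<Rightarrow> 'b \<otimes> 'a" where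
  "tensor_flip = (THE h. cu_morphism h \<and> (\<forall>a b. h (a \<otimes> b) = b \<otimes> a))"

definition tensor_assoc ::
  "('a::cu_semigroup \<otimes> 'b::cu_semigroup) \<otimes> 'c::cu_semigroup \<Rightarrow> 'a \<otimes> ('b \<otimes> 'c)" where
  "tensor_assoc = (THE h. cu_morphism h \<and> (\<forall>a b c. h ((a \<otimes> b) \<otimes> c) = a \<otimes> (b \<otimes> c)))"

definition tensor_unassoc ::
  "'a::cu_semigroup \<otimes> ('b::cu_semigroup \<otimes> 'c::cu_semigroup) \<Rightarrow> ('a \<otimes> 'b) \<otimes> 'c" where
  "tensor_unassoc = (THE h. cu_morphism h \<and> (\<forall>a b c. h (a \<otimes> (b \<otimes> c)) = (a \<otimes> b) \<otimes> c))"

text \<open>The flip of the two middle factors, \<open>id \<otimes> \<sigma> \<otimes> id\<close>, with the associativity isomorphisms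
  made explicit.\<close>

definition tensor_mid_flip ::
  "('a::cu_semigroup \<otimes> 'b::cu_semigroup) \<otimes> ('c::cu_semigroup \<otimes> 'd::cu_semigroup) \<Rightarrow>
   ('a \<otimes> 'c) \<otimes> ('b \<otimes> 'd)" where
  "tensor_mid_flip =
     tensor_unassoc \<circ>
     tensor_map id (tensor_assoc \<circ> tensor_map tensor_flip id \<circ> tensor_unassoc) \<circ>
     tensor_assoc"

text \<open>The bijection from Cu-morphisms \<open>S \<rightarrow> \<lbrakk>T, P\<rbrakk>\<close> to Cu-morphisms \<open>S \<otimes> T \<rightarrow> P\<close>.\<close>

definition adjunct ::
  "('a::cu_semigroup \<Rightarrow> ('b::cu_semigroup, 'c::cu_semigroup) ihom) \<Rightarrow> 'a \<otimes> 'b \<Rightarrow> 'c" where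
  "adjunct \<alpha> = tensor_lift (\<lambda>a b. endpoint (\<alpha> a) b)"

definition eval_map :: "('a::cu_semigroup, 'b::cu_semigroup) ihom \<otimes> 'a \<Rightarrow> 'b" where
  "eval_map = adjunct id"

definition ext_tensor_map ::
  "('s1::cu_semigroup, 't1::cu_semigroup) ihom \<otimes> ('s2::cu_semigroup, 't2::cu_semigroup) ihom \<Rightarrow>
   ('s1 \<otimes> 's2, 't1 \<otimes> 't2) ihom" where
  "ext_tensor_map =
     (THE \<alpha>. cu_morphism \<alpha> \<and> adjunct \<alpha> = tensor_map eval_map eval_map \<circ> tensor_mid_flip)"

definition ext_tensor ::
  "('s1::cu_semigroup, 't1::cu_semigroup) ihom \<Rightarrow> ('s2::cu_semigroup, 't2::cu_semigroup) ihom \<Rightarrow>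
   ('s1 \<otimes> 's2, 't1 \<otimes> 't2) ihom" (infixr "\<boxtimes>" 75) where
  "x \<boxtimes> y = ext_tensor_map (x \<otimes> y)"

end

theory Submission
  imports Defs
begin

text \<open>Tensoring paths termwise respects \<open>\<lesssim>\<close>, and \<open>([f], [g]) \<mapsto> [f \<otimes> g]\<close> is a Cu-bimorphism
  on the internal homs: path cuts commute with termwise tensoring, which gives preservation of
  \<open>\<lless>\<close>. Since \<open>\<otimes>\<close> preserves suprema, the endpoint of \<open>[f \<otimes> g]\<close> at \<open>a \<otimes> b\<close> is the tensor product of
  the endpoints, so the Cu-morphism induced by this bimorphism has the adjunct that defines
  \<open>\<boxtimes>\<close>. It equals \<open>\<boxtimes>\<close> because a Cu-morphism into an internal hom is determined by its adjunct.\<close>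

section \<open>Morphisms and bimorphisms\<close>

lemma
  assumes "gen_cu_morphism f"
  shows gen_morphism_zero: "f 0 = 0"
    and gen_morphism_add: "f (a + b) = f a + f b"
    and gen_morphism_mono: "a \<le> b \<Longrightarrow> f a \<le> f b"
    and gen_morphism_lub: "incseq c \<Longrightarrow> is_lub (range c) s \<Longrightarrow> is_lub (range (\<lambda>n. f (c n))) (f s)"
  using assms by (auto simp: gen_cu_morphism_def dest: monoD)

text \<open>Monotonicity already makes \<open>f s\<close> an upper bound of the
  \<open>f (c n)\<close>, so preservation of suprema reduces to the last assumption.\<close>

lemma gen_cu_morphismI:
  fixes f :: "'a::cu_semigroup \<Rightarrow> 'b::cu_semigroup"
  assumes "f 0 = 0" "\<And>a b. f (a + b) = f a + f b" "\<And>a b. a \<le> b \<Longrightarrow> f a \<le> f b"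
    and "\<And>c s u. incseq c \<Longrightarrow> is_lub (range c) s \<Longrightarrow> (\<And>n. f (c n) \<le> u) \<Longrightarrow> f s \<le> u"
  shows "gen_cu_morphism f"
proof -
  have "is_lub (range (\<lambda>n. f (c n))) (f s)" if "incseq c" "is_lub (range c) s" for c s
    using assms(3) is_lub_upper[OF that(2)] assms(4)[OF that] by (intro is_lubI) auto
  with assms show ?thesis by (auto simp: gen_cu_morphism_def intro: monoI)
qed

lemma gen_cu_morphism_const_zero: "gen_cu_morphism (\<lambda>_. 0)"
  by (rule gen_cu_morphismI) auto

lemma gen_cu_morphism_comp:
  "gen_cu_morphism g \<Longrightarrow> gen_cu_morphism f \<Longrightarrow> gen_cu_morphism (\<lambda>a. g (f a))"
  by (auto simp: gen_cu_morphism_def monotone_def)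

lemma cu_morphism_gen: "cu_morphism f \<Longrightarrow> gen_cu_morphism f"
  by (simp add: cu_morphism_def)

lemma cu_morphism_comp: "cu_morphism g \<Longrightarrow> cu_morphism f \<Longrightarrow> cu_morphism (g \<circ> f)"
  using gen_cu_morphism_comp by (auto simp: cu_morphism_def comp_def)

lemma cu_morphism_id: "cu_morphism id"
  by (auto simp: cu_morphism_def gen_cu_morphism_def monotone_def)

text \<open>Continuity in one variable is joint continuity along a constant sequence in the
  other.\<close>

lemma gen_bimorphism_left: "gen_cu_bimorphism \<phi> \<Longrightarrow> gen_cu_morphism (\<lambda>a. \<phi> a b)"
  unfolding gen_cu_morphism_def
  using gen_bimorphism_lub[of \<phi> _ "\<lambda>_. b", OF _ _ _ _ is_lub_const]
  by (auto simp: monotone_def gen_bimorphism_zero_left gen_bimorphism_add_left gen_bimorphism_mono_left)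

lemma gen_bimorphism_right: "gen_cu_bimorphism \<phi> \<Longrightarrow> gen_cu_morphism (\<lambda>b. \<phi> a b)"
  unfolding gen_cu_morphism_def
  using gen_bimorphism_lub[of \<phi> "\<lambda>_. a", OF _ _ _ is_lub_const]
  by (auto simp: monotone_def gen_bimorphism_zero_right gen_bimorphism_add_right gen_bimorphism_mono_right)

text \<open>Separate continuity suffices: by monotonicity \<open>\<phi> (c k) (d n)\<close> lies
  below the diagonal term at \<open>max k n\<close>, so the iterated supremum does not exceed the
  diagonal one.\<close>

lemma gen_cu_bimorphismI:
  fixes \<phi> :: "'a::cu_semigroup \<Rightarrow> 'b::cu_semigroup \<Rightarrow> 'c::cu_semigroup"
  assumes l: "\<And>b. gen_cu_morphism (\<lambda>a. \<phi> a b)" and r: "\<And>a. gen_cu_morphism (\<lambda>b. \<phi> a b)"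
  shows "gen_cu_bimorphism \<phi>"
proof -
  have mono: "\<phi> a b \<le> \<phi> a' b'" if "a \<le> a'" "b \<le> b'" for a a' b b'
    using gen_morphism_mono[OF l that(1)] gen_morphism_mono[OF r that(2)] by (rule order.trans)
  have "is_lub (range (\<lambda>k. \<phi> (c k) (d k))) (\<phi> s t)"
    if c: "incseq c" "is_lub (range c) s" and d: "incseq d" "is_lub (range d) t" for c d s t
  proof (rule is_lubI)
    fix x assume "x \<in> range (\<lambda>k. \<phi> (c k) (d k))"
    then show "x \<le> \<phi> s t" using is_lub_upper[OF c(2)] is_lub_upper[OF d(2)] by (auto intro: mono)
  next
    fix u assume u: "\<And>x. x \<in> range (\<lambda>k. \<phi> (c k) (d k)) \<Longrightarrow> x \<le> u"
    have cd: "\<phi> (c k) (d n) \<le> u" for k n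
    proof -
      have "\<phi> (c k) (d n) \<le> \<phi> (c (max k n)) (d (max k n))"
        by (intro mono incseqD[OF c(1)] incseqD[OF d(1)]) auto
      also have "\<dots> \<le> u" using u by blast
      finally show ?thesis .
    qed
    have "\<phi> (c k) t \<le> u" for k
      using cd by (intro is_lub_least[OF gen_morphism_lub[OF r d]]) auto
    then show "\<phi> s t \<le> u"
      by (intro is_lub_least[OF gen_morphism_lub[OF l c]]) auto
  qed
  then show ?thesis
    unfolding gen_cu_bimorphism_def
    by (intro conjI allI impI)
      (auto intro: mono simp: gen_morphism_zero[OF l] gen_morphism_zero[OF r]
        gen_morphism_add[OF l] gen_morphism_add[OF r])
qed

lemma cu_bimorphism_gen: "cu_bimorphism \<phi> \<Longrightarrow> gen_cu_bimorphism \<phi>"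
  by (simp add: cu_bimorphism_def)

lemma cu_bimorphism_way_below: "cu_bimorphism \<phi> \<Longrightarrow> a' \<lless> a \<Longrightarrow> b' \<lless> b \<Longrightarrow> \<phi> a' b' \<lless> \<phi> a b"
  by (simp add: cu_bimorphism_def)

lemma gen_cu_bimorphism_swap: "gen_cu_bimorphism \<phi> \<Longrightarrow> gen_cu_bimorphism (\<lambda>b a. \<phi> a b)"
  by (rule gen_cu_bimorphismI) (erule gen_bimorphism_right gen_bimorphism_left)+

lemma cu_bimorphism_swap: "cu_bimorphism \<phi> \<Longrightarrow> cu_bimorphism (\<lambda>b a. \<phi> a b)"
  by (simp add: cu_bimorphism_def gen_cu_bimorphism_swap)

lemma cu_bimorphism_comp:
  assumes "cu_bimorphism \<phi>" "cu_morphism f" "cu_morphism g"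
  shows "cu_bimorphism (\<lambda>a b. \<phi> (f a) (g b))"
  unfolding cu_bimorphism_def
proof (intro conjI allI impI)
  note \<phi> = cu_bimorphism_gen[OF assms(1)]
  show "gen_cu_bimorphism (\<lambda>a b. \<phi> (f a) (g b))"
    by (intro gen_cu_bimorphismI gen_cu_morphism_comp[OF gen_bimorphism_left[OF \<phi>]]
        gen_cu_morphism_comp[OF gen_bimorphism_right[OF \<phi>]] cu_morphism_gen assms)
qed (use assms in \<open>auto simp: cu_bimorphism_def cu_morphism_def\<close>)

lemmas simple_tensor_gen = cu_bimorphism_gen[OF simple_tensor_bimorphism]
lemmas simple_tensor_left = gen_bimorphism_left[OF simple_tensor_gen]
lemmas simple_tensor_right = gen_bimorphism_right[OF simple_tensor_gen]
lemmas simple_tensor_way_below = cu_bimorphism_way_below[OF simple_tensor_bimorphism]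

section \<open>Maps out of tensor products\<close>

lemma
  assumes "cu_bimorphism \<phi>"
  shows cu_morphism_tensor_lift: "cu_morphism (tensor_lift \<phi>)"
    and tensor_lift_simple: "tensor_lift \<phi> (a \<otimes> b) = \<phi> a b"
  using theI'[OF tensor_universal[OF assms]] unfolding tensor_lift_def by simp_all

lemma teval_prec:
  assumes "\<And>a' a b' b. a' \<lless> a \<Longrightarrow> b' \<lless> b \<Longrightarrow> \<phi> a' b' \<lless> \<psi> a b" and "twb w y"
  shows "teval \<phi> w \<lless> teval \<psi> y"
  using assms(2)
proof (induction y arbitrary: w)
  case empty
  then show ?case by (simp add: zero_way_below)
next
  case (add p y)
  obtain a b where p: "p = (a, b)" by (cases p)
  from add.prems obtain a' b' w' where "w = add_mset (a', b') w'" "a' \<lless> a" "b' \<lless> b" "twb w' y"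
    unfolding p by (rule twb_add_msetE)
  with add.IH show ?case by (auto simp: p intro!: O3 assms(1))
qed

text \<open>If \<open>I \<lless> J\<close>, roundness inserts \<open>twb w z\<close> with
  \<open>z\<close> in the ideal of \<open>J\<close> and the lift of \<open>\<phi>\<close> at
  \<open>I\<close> at most \<open>teval \<phi> w\<close>, which is way below
  \<open>teval \<psi> z\<close>. Two maps are compared because a single member of a path need not
  preserve \<open>\<lless>\<close>.\<close>

lemma gen_tensor_lift_prec:
  fixes \<phi> \<psi> :: "'a::cu_semigroup \<Rightarrow> 'b::cu_semigroup \<Rightarrow> 'c::cu_semigroup"
  assumes \<phi>: "gen_cu_bimorphism \<phi>" and \<psi>: "gen_cu_bimorphism \<psi>"
    and "\<And>a' a b' b. a' \<lless> a \<Longrightarrow> b' \<lless> b \<Longrightarrow> \<phi> a' b' \<lless> \<psi> a b"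
  shows "gen_tensor_lift \<phi> \<prec> gen_tensor_lift \<psi>"
  unfolding mor_prec_def
proof (intro allI impI)
  fix I J :: "'a \<otimes> 'b" assume "I \<lless> J"
  then obtain y where y: "y \<in> Rep_tensor J" "I \<le> tdown y" unfolding tensor_way_below_iff by blast
  obtain z where z: "z \<in> Rep_tensor J" "tprec y z" using tideal_round[OF tideal_Rep y(1)] by blast
  obtain w where w: "tle y w" "twb w z" using z(2) unfolding tprec_iff by blast
  have "gen_tensor_lift \<phi> I \<le> gen_tensor_lift \<phi> (tdown y)"
    by (rule gen_morphism_mono[OF gen_tensor_lift_morphism[OF \<phi>] y(2)])
  also have "\<dots> = teval \<phi> y" by (rule gen_tensor_lift_tdown[OF \<phi>])
  also have "\<dots> \<le> teval \<phi> w" by (rule gen_bimorphism_teval_mono[OF \<phi> w(1)])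
  finally have "gen_tensor_lift \<phi> I \<lless> teval \<psi> z"
    using teval_prec[of \<phi> \<psi>, OF assms(3) w(2)] le_way_below_trans by blast
  then show "gen_tensor_lift \<phi> I \<lless> gen_tensor_lift \<psi> J"
    using is_lub_upper[OF gen_tensor_lift_lub[OF \<psi>, of J]] z(1) by (blast intro: way_below_le_trans)
qed

text \<open>Provides the associativity maps: a trilinear map is lifted in two variables while the
  third is held fixed. With \<open>c\<close> fixed only a generalized bimorphism can be expected, as
  \<open>c \<lless> c\<close> may fail; so \<open>\<lless>\<close> is treated jointly in all three
  variables.\<close>

lemma cu_bimorphism_gen_tensor_lift:
  fixes \<theta> :: "'a::cu_semigroup \<Rightarrow> 'b::cu_semigroup \<Rightarrow> 'c::cu_semigroup \<Rightarrow> 'd::cu_semigroup"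
  assumes ab: "\<And>c. gen_cu_bimorphism (\<lambda>a b. \<theta> a b c)" and c: "\<And>a b. gen_cu_morphism (\<theta> a b)"
    and wb: "\<And>a' a b' b c' c. a' \<lless> a \<Longrightarrow> b' \<lless> b \<Longrightarrow> c' \<lless> c \<Longrightarrow> \<theta> a' b' c' \<lless> \<theta> a b c"
  shows "cu_bimorphism (\<lambda>x c. gen_tensor_lift (\<lambda>a b. \<theta> a b c) x)"
proof -
  define L where "L c = gen_tensor_lift (\<lambda>a b. \<theta> a b c)" for c
  have L: "gen_cu_morphism (L c)" for c unfolding L_def by (rule gen_tensor_lift_morphism[OF ab])
  have L_simple: "L c (a \<otimes> b) = \<theta> a b c" for a b c unfolding L_def by (rule gen_tensor_lift_simple[OF ab])
  \<comment> \<open>For fixed \<open>y\<close> this is a finite sum of generalized Cu-morphisms in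
    \<open>c\<close>, hence continuous in \<open>c\<close>.\<close>
  have teval: "gen_cu_morphism (\<lambda>c. teval (\<lambda>a b. \<theta> a b c) y)" for y
    by (induction y) (auto simp: gen_cu_morphism_const_zero intro!: gen_cu_morphism_add c)
  have "gen_cu_morphism (\<lambda>c. L c x)" for x
  proof (rule gen_cu_morphismI)
    \<comment> \<open>Zero, sum and order relations in \<open>c\<close> are checked on elementary
      tensors, which determine generalized Cu-morphisms and their order.\<close>
    have "L 0 = (\<lambda>_. 0)"
      by (rule tensor_gen_morphism_eq[OF L gen_cu_morphism_const_zero])
        (simp add: L_simple gen_morphism_zero[OF c])
    then show "L 0 x = 0" by simp
    have "L (c + d) = (\<lambda>x. L c x + L d x)" for c d
      by (rule tensor_gen_morphism_eq[OF L gen_cu_morphism_add[OF L L]])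
        (simp add: L_simple gen_morphism_add[OF c])
    then show "L (c + d) x = L c x + L d x" for c d by simp
    show mono: "L d x \<le> L e x" if "d \<le> e" for d e x
      by (rule tensor_gen_morphism_le[OF L L]) (simp add: L_simple gen_morphism_mono[OF c that])
    fix d s u assume d: "incseq d" "is_lub (range d) s" and u: "\<And>n. L (d n) x \<le> u"
    \<comment> \<open>Interchange of suprema: \<open>L s x\<close> is the supremum of
      \<open>teval\<close> over the ideal of \<open>x\<close>, and each such value is itself a
      supremum over \<open>n\<close>.\<close>
    show "L s x \<le> u"
      unfolding L_def
    proof (rule is_lub_least[OF gen_tensor_lift_lub[OF ab]], elim imageE, hypsubst)
      fix y assume y: "y \<in> Rep_tensor x"
      have "teval (\<lambda>a b. \<theta> a b (d n)) y \<le> u" for n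
        using is_lub_upper[OF gen_tensor_lift_lub[OF ab], of _ "d n" x] y u[of n, unfolded L_def]
        by (blast intro: order.trans)
      then show "teval (\<lambda>a b. \<theta> a b s) y \<le> u"
        by (intro is_lub_least[OF gen_morphism_lub[OF teval d]]) auto
    qed
  qed
  moreover have "L c' x' \<lless> L c x" if "x' \<lless> x" "c' \<lless> c" for x' x c' c
    using gen_tensor_lift_prec[OF ab ab, of c' c] wb[OF _ _ that(2)] that(1)
    unfolding mor_prec_def L_def by blast
  ultimately have "cu_bimorphism (\<lambda>x c. L c x)"
    unfolding cu_bimorphism_def using gen_cu_bimorphismI[of "\<lambda>x c. L c x", OF L] by blast
  then show ?thesis unfolding L_def .
qed

text \<open>Freezing \<open>c\<close> leaves generalized Cu-morphisms on the inner tensor product,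
  so uniqueness applies once on each level.\<close>

lemma gen_morphism_eq_assoc_left:
  fixes \<alpha> \<beta> :: "('a::cu_semigroup \<otimes> 'b::cu_semigroup) \<otimes> 'c::cu_semigroup \<Rightarrow> 'd::cu_semigroup"
  assumes "gen_cu_morphism \<alpha>" "gen_cu_morphism \<beta>" "\<And>a b c. \<alpha> ((a \<otimes> b) \<otimes> c) = \<beta> ((a \<otimes> b) \<otimes> c)"
  shows "\<alpha> = \<beta>"
proof (rule tensor_gen_morphism_eq[OF assms(1,2)])
  fix x c
  have "(\<lambda>x. \<alpha> (x \<otimes> c)) = (\<lambda>x. \<beta> (x \<otimes> c))"
    by (intro tensor_gen_morphism_eq gen_cu_morphism_comp[OF _ simple_tensor_left] assms)
  then show "\<alpha> (x \<otimes> c) = \<beta> (x \<otimes> c)" by (rule fun_cong)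
qed

lemma gen_morphism_eq_assoc_right:
  fixes \<alpha> \<beta> :: "'a::cu_semigroup \<otimes> ('b::cu_semigroup \<otimes> 'c::cu_semigroup) \<Rightarrow> 'd::cu_semigroup"
  assumes "gen_cu_morphism \<alpha>" "gen_cu_morphism \<beta>" "\<And>a b c. \<alpha> (a \<otimes> b \<otimes> c) = \<beta> (a \<otimes> b \<otimes> c)"
  shows "\<alpha> = \<beta>"
proof (rule tensor_gen_morphism_eq[OF assms(1,2)])
  fix a x
  have "(\<lambda>x. \<alpha> (a \<otimes> x)) = (\<lambda>x. \<beta> (a \<otimes> x))"
    by (intro tensor_gen_morphism_eq gen_cu_morphism_comp[OF _ simple_tensor_right] assms)
  then show "\<alpha> (a \<otimes> x) = \<beta> (a \<otimes> x)" by (rule fun_cong)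
qed

lemma gen_morphism_eq_four:
  fixes \<alpha> \<beta> :: "('a::cu_semigroup \<otimes> 'b::cu_semigroup) \<otimes> ('c::cu_semigroup \<otimes> 'd::cu_semigroup) \<Rightarrow> 'e::cu_semigroup"
  assumes "gen_cu_morphism \<alpha>" "gen_cu_morphism \<beta>"
    and "\<And>a b c d. \<alpha> ((a \<otimes> b) \<otimes> (c \<otimes> d)) = \<beta> ((a \<otimes> b) \<otimes> (c \<otimes> d))"
  shows "\<alpha> = \<beta>"
proof (rule gen_morphism_eq_assoc_left[OF assms(1,2)])
  fix a b x
  have "(\<lambda>x. \<alpha> ((a \<otimes> b) \<otimes> x)) = (\<lambda>x. \<beta> ((a \<otimes> b) \<otimes> x))"
    by (intro tensor_gen_morphism_eq gen_cu_morphism_comp[OF _ simple_tensor_right] assms)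
  then show "\<alpha> ((a \<otimes> b) \<otimes> x) = \<beta> ((a \<otimes> b) \<otimes> x)" by (rule fun_cong)
qed

section \<open>The flip, the associativity maps and the middle flip\<close>

lemma
  shows cu_morphism_tensor_flip: "cu_morphism (tensor_flip :: 'a::cu_semigroup \<otimes> 'b::cu_semigroup \<Rightarrow> _)"
    and tensor_flip_simple: "tensor_flip ((a::'a) \<otimes> (b::'b)) = b \<otimes> a"
  using theI'[OF tensor_universal[OF cu_bimorphism_swap[OF simple_tensor_bimorphism], where 'a = 'a and 'b = 'b]]
  unfolding tensor_flip_def by simp_all

lemma
  shows cu_morphism_tensor_assoc:
      "cu_morphism (tensor_assoc :: ('a::cu_semigroup \<otimes> 'b::cu_semigroup) \<otimes> 'c::cu_semigroup \<Rightarrow> _)"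
    and tensor_assoc_simple: "tensor_assoc (((a::'a) \<otimes> (b::'b)) \<otimes> (c::'c)) = a \<otimes> (b \<otimes> c)"
proof -
  let ?\<theta> = "\<lambda>a b c. (a::'a) \<otimes> ((b::'b) \<otimes> (c::'c))"
  have ab: "gen_cu_bimorphism (\<lambda>a b. ?\<theta> a b c)" for c
    by (intro gen_cu_bimorphismI simple_tensor_left
        gen_cu_morphism_comp[OF simple_tensor_right simple_tensor_left])
  have bi: "cu_bimorphism (\<lambda>x c. gen_tensor_lift (\<lambda>a b. ?\<theta> a b c) x)"
    by (intro cu_bimorphism_gen_tensor_lift[of ?\<theta>, OF ab]
        gen_cu_morphism_comp[OF simple_tensor_right simple_tensor_right] simple_tensor_way_below)
  \<comment> \<open>The definite description in \<open>tensor_assoc\<close> needs a unique solution.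
    One is obtained by lifting twice, first in \<open>a\<close> and \<open>b\<close>, then in the
    resulting pair.\<close>
  have "\<exists>!h. cu_morphism h \<and> (\<forall>a b c. h (((a::'a) \<otimes> (b::'b)) \<otimes> (c::'c)) = a \<otimes> (b \<otimes> c))"
  proof (rule ex1I)
    let ?h = "tensor_lift (\<lambda>x c. gen_tensor_lift (\<lambda>a b. ?\<theta> a b c) x)"
    show *: "cu_morphism ?h \<and> (\<forall>a b c. ?h ((a \<otimes> b) \<otimes> c) = a \<otimes> (b \<otimes> c))"
      using cu_morphism_tensor_lift[OF bi] by (simp add: tensor_lift_simple[OF bi] gen_tensor_lift_simple[OF ab])
    show "h = ?h" if "cu_morphism h \<and> (\<forall>a b c. h ((a \<otimes> b) \<otimes> c) = a \<otimes> (b \<otimes> c))" for h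
      using that * by (intro gen_morphism_eq_assoc_left cu_morphism_gen) auto
  qed
  from theI'[OF this] show "cu_morphism (tensor_assoc :: ('a \<otimes> 'b) \<otimes> 'c \<Rightarrow> _)"
    "tensor_assoc ((a \<otimes> b) \<otimes> c) = a \<otimes> (b \<otimes> c)"
    unfolding tensor_assoc_def by simp_all
qed

lemma
  shows cu_morphism_tensor_unassoc:
      "cu_morphism (tensor_unassoc :: 'a::cu_semigroup \<otimes> ('b::cu_semigroup \<otimes> 'c::cu_semigroup) \<Rightarrow> _)"
    and tensor_unassoc_simple: "tensor_unassoc ((a::'a) \<otimes> ((b::'b) \<otimes> (c::'c))) = (a \<otimes> b) \<otimes> c"
proof -
  \<comment> \<open>The variable \<open>a\<close> comes last because the lifting lemma holds the
    third variable fixed; swapping the resulting bimorphism puts it back in front.\<close>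
  let ?\<theta> = "\<lambda>b c a. ((a::'a) \<otimes> (b::'b)) \<otimes> (c::'c)"
  have bc: "gen_cu_bimorphism (\<lambda>b c. ?\<theta> b c a)" for a
    by (intro gen_cu_bimorphismI simple_tensor_right
        gen_cu_morphism_comp[OF simple_tensor_left simple_tensor_right])
  have bi: "cu_bimorphism (\<lambda>a x. gen_tensor_lift (\<lambda>b c. ?\<theta> b c a) x)"
    by (intro cu_bimorphism_swap[OF cu_bimorphism_gen_tensor_lift[of ?\<theta>, OF bc]]
        gen_cu_morphism_comp[OF simple_tensor_left simple_tensor_left] simple_tensor_way_below)
  have "\<exists>!h. cu_morphism h \<and> (\<forall>a b c. h ((a::'a) \<otimes> ((b::'b) \<otimes> (c::'c))) = (a \<otimes> b) \<otimes> c)"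
  proof (rule ex1I)
    let ?h = "tensor_lift (\<lambda>a x. gen_tensor_lift (\<lambda>b c. ?\<theta> b c a) x)"
    show *: "cu_morphism ?h \<and> (\<forall>a b c. ?h (a \<otimes> (b \<otimes> c)) = (a \<otimes> b) \<otimes> c)"
      using cu_morphism_tensor_lift[OF bi] by (simp add: tensor_lift_simple[OF bi] gen_tensor_lift_simple[OF bc])
    show "h = ?h" if "cu_morphism h \<and> (\<forall>a b c. h (a \<otimes> (b \<otimes> c)) = (a \<otimes> b) \<otimes> c)" for h
      using that * by (intro gen_morphism_eq_assoc_right cu_morphism_gen) auto
  qed
  from theI'[OF this] show "cu_morphism (tensor_unassoc :: 'a \<otimes> ('b \<otimes> 'c) \<Rightarrow> _)"
    "tensor_unassoc (a \<otimes> (b \<otimes> c)) = (a \<otimes> b) \<otimes> c"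
    unfolding tensor_unassoc_def by simp_all
qed

lemma
  shows cu_morphism_tensor_mid_flip: "cu_morphism (tensor_mid_flip ::
      ('a::cu_semigroup \<otimes> 'b::cu_semigroup) \<otimes> ('c::cu_semigroup \<otimes> 'd::cu_semigroup) \<Rightarrow> _)"
    and tensor_mid_flip_simple:
      "tensor_mid_flip (((a::'a) \<otimes> (b::'b)) \<otimes> ((c::'c) \<otimes> (d::'d))) = (a \<otimes> c) \<otimes> (b \<otimes> d)"
proof -
  note cu = cu_morphism_comp cu_morphism_tensor_map cu_morphism_id cu_morphism_tensor_flip
    cu_morphism_tensor_assoc cu_morphism_tensor_unassoc
  show "cu_morphism (tensor_mid_flip :: ('a \<otimes> 'b) \<otimes> ('c \<otimes> 'd) \<Rightarrow> _)"
    unfolding tensor_mid_flip_def by (intro cu)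
  \<comment> \<open>The element becomes \<open>a \<otimes> (b \<otimes> (c \<otimes> d))\<close>,
    then \<open>a \<otimes> (c \<otimes> (b \<otimes> d))\<close> by flipping inside the right
    factor, and is finally rebracketed.\<close>
  show "tensor_mid_flip ((a \<otimes> b) \<otimes> (c \<otimes> d)) = (a \<otimes> c) \<otimes> (b \<otimes> d)"
    unfolding tensor_mid_flip_def
    by (simp add: tensor_map_simple tensor_assoc_simple tensor_unassoc_simple tensor_flip_simple
        cu_morphism_gen cu del: comp_apply add: o_apply)
qed

section \<open>The endpoint map\<close>

lemma ihom_path_cases:
  fixes x :: "('a::cu_semigroup, 'b::cu_semigroup) ihom"
  obtains f where "cu_path f" "x = path_class f"
  using ihom_cases[of x] unfolding path_class_def by blast

lemma ihom_seq_paths: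
  fixes c :: "nat \<Rightarrow> ('a::cu_semigroup, 'b::cu_semigroup) ihom"
  assumes "incseq c"
  obtains F where "\<And>n. cu_path (F n)" "c = (\<lambda>n. path_class (F n))" "\<And>n. F n \<lesssim> F (Suc n)"
proof -
  have "\<exists>F. \<forall>n. cu_path (F n) \<and> c n = path_class (F n)"
    by (intro choice allI) (metis ihom_path_cases)
  then obtain F where F: "\<And>n. cu_path (F n)" "c = (\<lambda>n. path_class (F n))" by blast
  have "F n \<lesssim> F (Suc n)" for n using incseq_SucD[OF assms, of n] F by (simp add: path_class_le_iff)
  with F that show ?thesis by blast
qed

section \<open>Endpoints as suprema of sequences\<close>

lemma path_mono:
  assumes f: "cu_path f" and "l \<in> IQ" "m \<in> IQ" "l \<le> m" shows "f l a \<le> f m a"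
proof (cases "l = m")
  case False
  with assms show ?thesis by (intro prec_imp_le cu_path_morphism[OF f] cu_path_prec[OF f]) auto
qed simp

text \<open>A cofinal sequence turns suprema over \<open>IQ\<close> into suprema of sequences, to
  which \<open>O1\<close> and \<open>O4\<close> apply. The shift by 2 makes it start at 1/2; a shift
  by 1 would start at 0, outside \<open>IQ\<close>.\<close>

definition IQ_seq :: "nat \<Rightarrow> rat" where
  "IQ_seq n = 1 - 1 / of_nat (n + 2)"

lemma IQ_seq_mem: "IQ_seq n \<in> IQ"
  by (simp add: IQ_seq_def IQ_def)

lemma IQ_seq_incseq: "incseq IQ_seq"
  by (intro incseq_SucI) (simp add: IQ_seq_def field_simps)

lemma IQ_seq_cofinal:
  assumes "l \<in> IQ" obtains n where "l \<le> IQ_seq n"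
proof -
  have "0 < 1 - l" using assms by (simp add: IQ_def)
  then obtain n where n: "1 / of_nat (Suc n) < 1 - l"
    using reals_Archimedean[of "1 - l"] by (auto simp: inverse_eq_divide)
  have "1 / of_nat (n + 2) \<le> 1 / (of_nat (Suc n) :: rat)" by (intro divide_left_mono) auto
  with n have "l \<le> IQ_seq n" by (simp add: IQ_seq_def)
  then show ?thesis by (rule that)
qed

lemma path_IQ_seq_incseq: "cu_path f \<Longrightarrow> incseq (\<lambda>n. f (IQ_seq n) a)"
  using incseq_SucD[OF IQ_seq_incseq] by (intro incseq_SucI path_mono IQ_seq_mem) auto

text \<open>\<open>endpoint\<close> is given by \<open>the_lub\<close>, which is meaningful only
  where a supremum exists. \<open>O1\<close> provides one along \<open>IQ_seq\<close>, and
  cofinality carries it over to all of \<open>IQ\<close>.\<close>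

lemma
  assumes f: "cu_path f"
  shows endpoint_seq_lub: "is_lub (range (\<lambda>n. f (IQ_seq n) a)) (endpoint (path_class f) a)"
    and endpoint_IQ_lub: "is_lub ((\<lambda>l. f l a) ` IQ) (endpoint (path_class f) a)"
proof -
  obtain s where s: "is_lub (range (\<lambda>n. f (IQ_seq n) a)) s"
    using O1[OF path_IQ_seq_incseq[OF f]] by blast
  have s': "is_lub ((\<lambda>l. f l a) ` IQ) s"
  proof (rule is_lub_cofinal[OF s])
    show "\<exists>y\<in>(\<lambda>l. f l a) ` IQ. x \<le> y" if "x \<in> range (\<lambda>n. f (IQ_seq n) a)" for x
      using that IQ_seq_mem by blast
    fix y assume "y \<in> (\<lambda>l. f l a) ` IQ"
    then obtain l where l: "l \<in> IQ" "y = f l a" by blast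
    obtain n where "l \<le> IQ_seq n" using l(1) by (rule IQ_seq_cofinal)
    then show "\<exists>x\<in>range (\<lambda>n. f (IQ_seq n) a). y \<le> x"
      using path_mono[OF f l(1) IQ_seq_mem] l(2) by blast
  qed
  then have "endpoint (path_class f) a = s"
    by (simp add: endpoint_path_class[OF f] the_lub_eqI)
  with s s' show "is_lub (range (\<lambda>n. f (IQ_seq n) a)) (endpoint (path_class f) a)"
    "is_lub ((\<lambda>l. f l a) ` IQ) (endpoint (path_class f) a)" by simp_all
qed

lemma path_le_endpoint: "cu_path f \<Longrightarrow> l \<in> IQ \<Longrightarrow> f l a \<le> endpoint (path_class f) a"
  by (rule is_lub_upper[OF endpoint_IQ_lub]) auto

lemma endpoint_least:
  "cu_path f \<Longrightarrow> (\<And>l. l \<in> IQ \<Longrightarrow> f l a \<le> u) \<Longrightarrow> endpoint (path_class f) a \<le> u"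
  by (rule is_lub_least[OF endpoint_IQ_lub]) auto

text \<open>Being way below \<open>path_class g\<close> means lying below some cut of
  \<open>g\<close>, and every member of the cut at \<open>l\<close> precedes \<open>g l\<close>. So
  the whole path \<open>f\<close>, and with it its endpoint, is bounded by a single member of
  \<open>g\<close>.\<close>

lemma path_class_way_belowD:
  assumes f: "cu_path f" and g: "cu_path g" and "path_class f \<lless> path_class g"
  obtains l where "l \<in> IQ" "\<And>a. endpoint (path_class f) a \<le> g l a"
proof -
  obtain l where l: "l \<in> IQ" "f \<lesssim> path_cut g l"
    using assms ihom_way_below_iff[OF f g] by (auto simp: path_class_def)
  have "f k a \<le> g l a" if k: "k \<in> IQ" for k a
  proof -
    obtain k' where "k' \<in> IQ" "f k \<prec> path_cut g l k'" using l(2) k unfolding path_le_def by blast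
    then have "f k \<prec> g l" using path_cut_prec[OF g l(1)] prec_trans by blast
    then show ?thesis by (rule prec_imp_le[OF cu_path_morphism[OF f k]])
  qed
  then show ?thesis using that l(1) endpoint_least[OF f] by blast
qed

lemma zero_path_class: "0 = path_class (\<lambda>_ _. 0)"
  by (simp add: path_class_def zero_ihom.abs_eq)

lemma gen_cu_morphism_endpoint: "gen_cu_morphism (endpoint x)"
proof -
  obtain f where f: "cu_path f" "x = path_class f" by (rule ihom_path_cases)
  note fm = cu_path_morphism[OF f(1)]
  note lub = endpoint_seq_lub[OF f(1)] and inc = path_IQ_seq_incseq[OF f(1)]
  show ?thesis
    unfolding f(2)
  proof (rule gen_cu_morphismI)
    show "endpoint (path_class f) 0 = 0"
      by (rule is_lub_unique[OF lub]) (simp add: gen_morphism_zero[OF fm] IQ_seq_mem is_lub_def)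
    fix a b
    have "is_lub (range (\<lambda>n. f (IQ_seq n) (a + b))) (endpoint (path_class f) a + endpoint (path_class f) b)"
      using O4[OF inc inc lub lub] by (simp add: gen_morphism_add[OF fm] IQ_seq_mem)
    then show "endpoint (path_class f) (a + b) = endpoint (path_class f) a + endpoint (path_class f) b"
      by (rule is_lub_unique[OF lub])
    show "endpoint (path_class f) a \<le> endpoint (path_class f) b" if "a \<le> b"
      using gen_morphism_mono[OF fm that] path_le_endpoint[OF f(1)] order.trans
      by (intro endpoint_least[OF f(1)]) blast
  next
    fix c s u assume c: "incseq c" "is_lub (range c) s" and u: "\<And>n. endpoint (path_class f) (c n) \<le> u"
    \<comment> \<open>Interchange of suprema: each \<open>f l\<close> is continuous, so the bound
      passes to \<open>s\<close> before the supremum over \<open>l\<close> is taken.\<close>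
    have "f l s \<le> u" if l: "l \<in> IQ" for l
      using path_le_endpoint[OF f(1) l] u order.trans
      by (intro is_lub_least[OF gen_morphism_lub[OF fm[OF l] c]]) blast
    then show "endpoint (path_class f) s \<le> u" by (rule endpoint_least[OF f(1)])
  qed
qed

lemma gen_cu_morphism_endpoint_left:
  fixes a :: "'a::cu_semigroup"
  shows "gen_cu_morphism (\<lambda>x :: ('a, 'b::cu_semigroup) ihom. endpoint x a)"
proof (rule gen_cu_morphismI)
  show "endpoint (0 :: ('a, 'b) ihom) a = 0"
    unfolding zero_path_class
    by (rule is_lub_unique[OF endpoint_seq_lub[OF cu_path_zero] is_lub_const])
next
  fix x y :: "('a, 'b) ihom"
  obtain f where f: "cu_path f" "x = path_class f" by (rule ihom_path_cases)
  obtain g where g: "cu_path g" "y = path_class g" by (rule ihom_path_cases)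
  note seq = path_IQ_seq_incseq endpoint_seq_lub
  show "endpoint (x + y) a = endpoint x a + endpoint y a"
    unfolding f(2) g(2) path_class_add[OF f(1) g(1)]
    by (rule is_lub_unique[OF endpoint_seq_lub[OF cu_path_add[OF f(1) g(1)]]])
      (intro O4 seq f(1) g(1))
  show "endpoint x a \<le> endpoint y a" if "x \<le> y"
    unfolding f(2) g(2)
  proof (rule endpoint_least[OF f(1)])
    fix l assume l: "l \<in> IQ"
    have "f \<lesssim> g" using that f g by (simp add: path_class_le_iff)
    then obtain m where m: "m \<in> IQ" "f l \<prec> g m" using l unfolding path_le_def by blast
    have "f l a \<le> g m a" by (rule prec_imp_le[OF cu_path_morphism[OF f(1) l] m(2)])
    then show "f l a \<le> endpoint (path_class g) a" using path_le_endpoint[OF g(1) m(1)] by (rule order.trans)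
  qed
next
  fix c :: "nat \<Rightarrow> ('a, 'b) ihom" and s u
  assume c: "incseq c" "is_lub (range c) s" and u: "\<And>n. endpoint (c n) a \<le> u"
  obtain F where F: "\<And>n. cu_path (F n)" "c = (\<lambda>n. path_class (F n))" "\<And>n. F n \<lesssim> F (Suc n)"
    using c(1) by (rule ihom_seq_paths) blast
  obtain h where h: "cu_path h" "s = path_class h" by (rule ihom_path_cases)
  show "endpoint s a \<le> u"
    unfolding h(2)
  proof (rule endpoint_least[OF h(1)])
    fix t assume t: "t \<in> IQ"
    \<comment> \<open>As \<open>h\<close> represents the supremum of the classes of the
      \<open>F n\<close>, each of its members precedes a member of some \<open>F n\<close>.\<close>
    obtain n m where nm: "m \<in> IQ" "h t \<prec> F n m"
      using ihom_lubD[of F, OF F(1,3) h(1) _ t] c(2) F(2) h(2) by (auto simp: path_class_def)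
    have "h t a \<le> F n m a" by (rule prec_imp_le[OF cu_path_morphism[OF h(1) t] nm(2)])
    also have "\<dots> \<le> endpoint (path_class (F n)) a" by (rule path_le_endpoint[OF F(1) nm(1)])
    also have "\<dots> \<le> u" using u[of n] F(2) by simp
    finally show "h t a \<le> u" .
  qed
qed

lemma cu_bimorphism_endpoint:
  "cu_bimorphism (\<lambda>(x :: ('a::cu_semigroup, 'b::cu_semigroup) ihom) a. endpoint x a)"
  unfolding cu_bimorphism_def
proof (intro conjI allI impI)
  show "gen_cu_bimorphism (\<lambda>(x :: ('a, 'b) ihom) a. endpoint x a)"
    by (intro gen_cu_bimorphismI gen_cu_morphism_endpoint_left gen_cu_morphism_endpoint)
  fix x' x :: "('a, 'b) ihom" and a' a :: 'a assume wb: "x' \<lless> x" "a' \<lless> a"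
  obtain f where f: "cu_path f" "x' = path_class f" by (rule ihom_path_cases)
  obtain g where g: "cu_path g" "x = path_class g" by (rule ihom_path_cases)
  obtain l where l: "l \<in> IQ" "\<And>a. endpoint (path_class f) a \<le> g l a"
    using path_class_way_belowD[OF f(1) g(1)] wb(1) f(2) g(2) by blast
  \<comment> \<open>A strictly larger index is taken because \<open>g l\<close> alone need not
    preserve \<open>\<lless>\<close>, whereas \<open>g l \<prec> g m\<close>.\<close>
  obtain m where m: "m \<in> IQ" "l < m" using IQ_gt[OF l(1)] by blast
  have "g l a' \<lless> g m a" using cu_path_prec[OF g(1) l(1) m] wb(2) by (simp add: mor_prec_def)
  then show "endpoint x' a' \<lless> endpoint x a"
    unfolding f(2) g(2) using l(2) path_le_endpoint[OF g(1) m(1)]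
    by (blast intro: le_way_below_trans way_below_le_trans)
qed

section \<open>Adjunction\<close>

lemma cu_bimorphism_adjunct: "cu_morphism \<alpha> \<Longrightarrow> cu_bimorphism (\<lambda>a b. endpoint (\<alpha> a) b)"
  using cu_bimorphism_comp[OF cu_bimorphism_endpoint _ cu_morphism_id, of \<alpha>] by simp

lemma
  assumes "cu_morphism \<alpha>"
  shows cu_morphism_adjunct: "cu_morphism (adjunct \<alpha>)"
    and adjunct_simple: "adjunct \<alpha> (a \<otimes> b) = endpoint (\<alpha> a) b"
  unfolding adjunct_def
  using cu_morphism_tensor_lift[OF cu_bimorphism_adjunct[OF assms]]
    tensor_lift_simple[OF cu_bimorphism_adjunct[OF assms]] by simp_all

lemma cu_morphism_eval_map: "cu_morphism eval_map"
  and eval_map_simple: "eval_map (x \<otimes> a) = endpoint x a"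
  unfolding eval_map_def by (simp_all add: cu_morphism_adjunct adjunct_simple cu_morphism_id)

text \<open>The endpoint map itself need not be injective. What makes the adjunction injective is that
  Cu-morphisms preserve \<open>\<lless>\<close>: if \<open>a' \<lless> a\<close>, the endpoint of \<open>\<beta> a'\<close> is bounded by a member of a
  path representing \<open>\<beta> a\<close>, and then so is every member of a path representing \<open>\<alpha> a'\<close>.\<close>

lemma endpoint_le_imp_le:
  fixes \<alpha> \<beta> :: "'a::cu_semigroup \<Rightarrow> ('b::cu_semigroup, 'c::cu_semigroup) ihom"
  assumes \<alpha>: "gen_cu_morphism \<alpha>" and \<beta>: "cu_morphism \<beta>"
    and le: "\<And>a b. endpoint (\<alpha> a) b \<le> endpoint (\<beta> a) b"
  shows "\<alpha> a \<le> \<beta> a"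
proof -
  have *: "\<alpha> a' \<le> \<beta> a" if "a' \<lless> a" for a'
  proof -
    obtain f where f: "cu_path f" "\<alpha> a' = path_class f" by (rule ihom_path_cases)
    obtain g where g: "cu_path g" "\<beta> a' = path_class g" by (rule ihom_path_cases)
    obtain h where h: "cu_path h" "\<beta> a = path_class h" by (rule ihom_path_cases)
    have "path_class g \<lless> path_class h"
      using \<beta> that unfolding g(2)[symmetric] h(2)[symmetric] cu_morphism_def by blast
    then obtain l where l: "l \<in> IQ" "\<And>b. endpoint (path_class g) b \<le> h l b"
      using path_class_way_belowD[OF g(1) h(1)] by blast
    have "f m \<prec> h l" if m: "m \<in> IQ" for m
      unfolding mor_prec_def
    proof (intro allI impI)
      fix b' b :: 'b assume b: "b' \<lless> b"
      \<comment> \<open>Inserting \<open>f k\<close> with \<open>m < k\<close> supplies the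
        \<open>\<lless>\<close> that the pointwise inequality of endpoints does not give.\<close>
      obtain k where k: "k \<in> IQ" "m < k" using IQ_gt[OF m] by blast
      have "f m b' \<lless> f k b" using cu_path_prec[OF f(1) m k] b by (simp add: mor_prec_def)
      moreover have "f k b \<le> endpoint (path_class f) b" by (rule path_le_endpoint[OF f(1) k(1)])
      moreover have "\<dots> \<le> endpoint (path_class g) b" using le[of a' b] f(2) g(2) by simp
      ultimately show "f m b' \<lless> h l b" using l(2)[of b] by (blast intro: way_below_le_trans)
    qed
    then have "f \<lesssim> h" using l(1) unfolding path_le_def by blast
    then show ?thesis using f h by (simp add: path_class_le_iff)
  qed
  \<comment> \<open>Since \<open>\<alpha>\<close> preserves suprema, the bound for all
    \<open>a' \<lless> a\<close> extends to \<open>a\<close> itself.\<close>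
  obtain c where c: "incseq c" "\<And>n. c n \<lless> a" "is_lub (range c) a" by (rule cu_approx[of a]) blast
  show ?thesis using * c(2) by (intro is_lub_least[OF gen_morphism_lub[OF \<alpha> c(1,3)]]) blast
qed

lemma adjunct_inj:
  assumes "cu_morphism \<alpha>" "cu_morphism \<beta>" "adjunct \<alpha> = adjunct \<beta>"
  shows "\<alpha> = \<beta>"
proof
  fix a
  have "endpoint (\<alpha> a) b = endpoint (\<beta> a) b" for a b
    using adjunct_simple[OF assms(1)] adjunct_simple[OF assms(2)] assms(3) by metis
  then show "\<alpha> a = \<beta> a"
    by (intro order.antisym endpoint_le_imp_le cu_morphism_gen assms) auto
qed

section \<open>Tensor products of paths\<close>

text \<open>Replaces the definite description by an explicit supremum over a round ideal, so that
  \<open>gen_tensor_lift_prec\<close> applies.\<close>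

lemma tensor_map_eq_lift:
  "gen_cu_morphism f \<Longrightarrow> gen_cu_morphism g \<Longrightarrow> tensor_map f g = gen_tensor_lift (\<lambda>a b. f a \<otimes> g b)"
  by (intro tensor_gen_morphism_eq gen_cu_morphism_tensor_map gen_tensor_lift_morphism
      gen_cu_bimorphism_tensor_map)
    (simp_all add: tensor_map_simple gen_tensor_lift_simple gen_cu_bimorphism_tensor_map)

lemma tensor_map_prec:
  assumes "gen_cu_morphism f" "gen_cu_morphism f'" "gen_cu_morphism g" "gen_cu_morphism g'"
    and "f \<prec> f'" "g \<prec> g'"
  shows "tensor_map f g \<prec> tensor_map f' g'"
  using assms(5,6) unfolding tensor_map_eq_lift[OF assms(1,3)] tensor_map_eq_lift[OF assms(2,4)]
  by (intro gen_tensor_lift_prec gen_cu_bimorphism_tensor_map assms(1-4))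
    (simp add: mor_prec_def simple_tensor_way_below)

lemma cu_path_tensor: "cu_path f \<Longrightarrow> cu_path g \<Longrightarrow> cu_path (\<lambda>l. tensor_map (f l) (g l))"
  by (simp add: cu_path_def gen_cu_morphism_tensor_map tensor_map_prec)

text \<open>The two factors may be dominated at different indices; the larger index serves
  both.\<close>

lemma path_tensor_prec:
  assumes "cu_path f'" "cu_path g'" "gen_cu_morphism f" "gen_cu_morphism g"
    and "m \<in> IQ" "n \<in> IQ" "f \<prec> f' m" "g \<prec> g' n"
  shows "\<exists>k\<in>IQ. tensor_map f g \<prec> tensor_map (f' k) (g' k)"
proof
  show k: "max m n \<in> IQ" using assms(5,6) by (rule IQ_max)
  have "f \<prec> f' (max m n)" by (rule prec_path_mono[OF assms(1,7,5) k]) simp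
  moreover have "g \<prec> g' (max m n)" by (rule prec_path_mono[OF assms(2,8,6) k]) simp
  ultimately show "tensor_map f g \<prec> tensor_map (f' (max m n)) (g' (max m n))"
    by (intro tensor_map_prec assms(3,4) cu_path_morphism[OF _ k] assms(1,2))
qed

lemma path_tensor_le:
  assumes "cu_path f" "cu_path g" "cu_path f'" "cu_path g'" "f \<lesssim> f'" "g \<lesssim> g'"
  shows "(\<lambda>l. tensor_map (f l) (g l)) \<lesssim> (\<lambda>l. tensor_map (f' l) (g' l))"
  unfolding path_le_def
proof
  fix l assume l: "l \<in> IQ"
  obtain m where m: "m \<in> IQ" "f l \<prec> f' m" using assms(5) l unfolding path_le_def by blast
  obtain n where n: "n \<in> IQ" "g l \<prec> g' n" using assms(6) l unfolding path_le_def by blast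
  show "\<exists>k\<in>IQ. tensor_map (f l) (g l) \<prec> tensor_map (f' k) (g' k)"
    by (rule path_tensor_prec[OF assms(3,4) cu_path_morphism[OF assms(1) l]
          cu_path_morphism[OF assms(2) l] m(1) n(1) m(2) n(2)])
qed

section \<open>The tensor bimorphism on internal homs\<close>

text \<open>The candidate for \<open>\<boxtimes>\<close>, given on representatives so that its value
  on path classes is explicit.\<close>

lift_definition ihom_tensor ::
  "('s1::cu_semigroup, 't1::cu_semigroup) ihom \<Rightarrow> ('s2::cu_semigroup, 't2::cu_semigroup) ihom \<Rightarrow>
   ('s1 \<otimes> 's2, 't1 \<otimes> 't2) ihom"
  is "\<lambda>f g l. tensor_map (f l) (g l)"
  by (simp add: path_equiv_def cu_path_tensor path_tensor_le)

lemma ihom_tensor_path_class: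
  "cu_path f \<Longrightarrow> cu_path g \<Longrightarrow>
    ihom_tensor (path_class f) (path_class g) = path_class (\<lambda>l. tensor_map (f l) (g l))"
  by (simp add: path_class_def ihom_tensor.abs_eq path_equiv_refl)

text \<open>Identities such as \<open>tensor_map_add_left\<close> are available for generalized
  Cu-morphisms, hence at indices in \<open>IQ\<close>. This suffices, since
  \<open>\<lesssim>\<close> sees no other values.\<close>

lemma path_class_cong:
  assumes "cu_path f" "\<And>l. l \<in> IQ \<Longrightarrow> f l = g l"
  shows "path_class f = path_class g"
proof -
  have g: "cu_path g" using assms by (simp add: cu_path_def)
  have "f \<lesssim> g" "g \<lesssim> f" using path_le_refl[OF assms(1)] assms(2) by (simp_all add: path_le_def)
  then show ?thesis by (simp add: path_class_eq_iff[OF assms(1) g])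
qed

lemma tensor_map_zero_left: "gen_cu_morphism g \<Longrightarrow> tensor_map (\<lambda>_. 0) g = (\<lambda>_. 0)"
  by (intro tensor_gen_morphism_eq gen_cu_morphism_tensor_map gen_cu_morphism_const_zero)
    (simp_all add: tensor_map_simple gen_cu_morphism_const_zero gen_bimorphism_zero_left[OF simple_tensor_gen])

lemma tensor_map_zero_right: "gen_cu_morphism f \<Longrightarrow> tensor_map f (\<lambda>_. 0) = (\<lambda>_. 0)"
  by (intro tensor_gen_morphism_eq gen_cu_morphism_tensor_map gen_cu_morphism_const_zero)
    (simp_all add: tensor_map_simple gen_cu_morphism_const_zero gen_bimorphism_zero_right[OF simple_tensor_gen])

lemma tensor_map_add_left:
  "gen_cu_morphism f \<Longrightarrow> gen_cu_morphism f' \<Longrightarrow> gen_cu_morphism g \<Longrightarrow>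
    tensor_map (\<lambda>a. f a + f' a) g = (\<lambda>x. tensor_map f g x + tensor_map f' g x)"
  by (intro tensor_gen_morphism_eq gen_cu_morphism_tensor_map gen_cu_morphism_add)
    (simp_all add: tensor_map_simple gen_cu_morphism_add gen_bimorphism_add_left[OF simple_tensor_gen])

lemma tensor_map_add_right:
  "gen_cu_morphism f \<Longrightarrow> gen_cu_morphism g \<Longrightarrow> gen_cu_morphism g' \<Longrightarrow>
    tensor_map f (\<lambda>a. g a + g' a) = (\<lambda>x. tensor_map f g x + tensor_map f g' x)"
  by (intro tensor_gen_morphism_eq gen_cu_morphism_tensor_map gen_cu_morphism_add)
    (simp_all add: tensor_map_simple gen_cu_morphism_add gen_bimorphism_add_right[OF simple_tensor_gen])

lemma ihom_tensor_mono: "x \<le> x' \<Longrightarrow> y \<le> y' \<Longrightarrow> ihom_tensor x y \<le> ihom_tensor x' y'"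
  by (cases x rule: ihom_path_cases, cases x' rule: ihom_path_cases,
      cases y rule: ihom_path_cases, cases y' rule: ihom_path_cases)
    (simp add: ihom_tensor_path_class path_class_le_iff cu_path_tensor path_tensor_le)

lemma cu_bimorphism_ihom_tensor:
  "cu_bimorphism (ihom_tensor :: ('s1::cu_semigroup, 't1::cu_semigroup) ihom \<Rightarrow>
    ('s2::cu_semigroup, 't2::cu_semigroup) ihom \<Rightarrow> _)"
  unfolding cu_bimorphism_def gen_cu_bimorphism_def
proof (intro conjI allI impI)
  fix x x' :: "('s1, 't1) ihom" and y y' :: "('s2, 't2) ihom"
  obtain f where f: "cu_path f" "x = path_class f" by (rule ihom_path_cases)
  obtain f' where f': "cu_path f'" "x' = path_class f'" by (rule ihom_path_cases)
  obtain g where g: "cu_path g" "y = path_class g" by (rule ihom_path_cases)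
  obtain g' where g': "cu_path g'" "y' = path_class g'" by (rule ihom_path_cases)
  note mor = cu_path_morphism[OF f(1)] cu_path_morphism[OF f'(1)] cu_path_morphism[OF g(1)]
    cu_path_morphism[OF g'(1)]
  show "ihom_tensor x (0 :: ('s2, 't2) ihom) = 0"
    unfolding f(2) zero_path_class ihom_tensor_path_class[OF f(1) cu_path_zero]
    by (rule path_class_cong[OF cu_path_tensor[OF f(1) cu_path_zero]]) (simp add: tensor_map_zero_right mor)
  show "ihom_tensor (0 :: ('s1, 't1) ihom) y = 0"
    unfolding g(2) zero_path_class ihom_tensor_path_class[OF cu_path_zero g(1)]
    by (rule path_class_cong[OF cu_path_tensor[OF cu_path_zero g(1)]]) (simp add: tensor_map_zero_left mor)
  show "ihom_tensor (x + x') y = ihom_tensor x y + ihom_tensor x' y"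
    unfolding f(2) f'(2) g(2)
    by (simp add: path_class_add ihom_tensor_path_class f g f' cu_path_add cu_path_tensor)
      (rule path_class_cong, simp_all add: cu_path_tensor cu_path_add f g f' tensor_map_add_left mor)
  show "ihom_tensor x (y + y') = ihom_tensor x y + ihom_tensor x y'"
    unfolding f(2) g(2) g'(2)
    by (simp add: path_class_add ihom_tensor_path_class f g g' cu_path_add cu_path_tensor)
      (rule path_class_cong, simp_all add: cu_path_tensor cu_path_add f g g' tensor_map_add_right mor)
  show "ihom_tensor x y \<le> ihom_tensor x' y" if "x \<le> x'" using that by (simp add: ihom_tensor_mono)
  show "ihom_tensor x y \<le> ihom_tensor x y'" if "y \<le> y'" using that by (simp add: ihom_tensor_mono)
  show "ihom_tensor x' y' \<lless> ihom_tensor x y" if wb: "x' \<lless> x" "y' \<lless> y"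
  proof -
    obtain l where l: "l \<in> IQ" "f' \<lesssim> path_cut f l"
      using wb(1) f f' ihom_way_below_iff by (auto simp: path_class_def)
    obtain m where m: "m \<in> IQ" "g' \<lesssim> path_cut g m"
      using wb(2) g g' ihom_way_below_iff by (auto simp: path_class_def)
    \<comment> \<open>One index for both factors, strictly above \<open>l\<close> and
      \<open>m\<close> because \<open>path_cut_mono\<close> compares cuts at strictly increasing
      indices.\<close>
    obtain k where k: "k \<in> IQ" "max l m < k" using IQ_gt[OF IQ_max[OF l(1) m(1)]] by blast
    have "f' \<lesssim> path_cut f k"
      by (rule path_le_trans[OF l(2) path_cut_mono[OF f(1) k(1) l(1)]]) (use k in simp)
    moreover have "g' \<lesssim> path_cut g k"
      by (rule path_le_trans[OF m(2) path_cut_mono[OF g(1) k(1) m(1)]]) (use k in simp)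
    ultimately have "(\<lambda>l. tensor_map (f' l) (g' l)) \<lesssim> (\<lambda>l. tensor_map (path_cut f k l) (path_cut g k l))"
      by (intro path_tensor_le cu_path_cut f(1) g(1) f'(1) g'(1) k(1))
    \<comment> \<open>Cutting only rescales the index, so it commutes with termwise
      tensoring.\<close>
    also have "(\<lambda>l. tensor_map (path_cut f k l) (path_cut g k l)) = path_cut (\<lambda>l. tensor_map (f l) (g l)) k"
      by (simp add: path_cut_def fun_eq_iff)
    finally show ?thesis
      unfolding f(2) g(2) f'(2) g'(2) ihom_tensor_path_class[OF f(1) g(1)] ihom_tensor_path_class[OF f'(1) g'(1)]
      unfolding path_class_def ihom_way_below_iff[OF cu_path_tensor[OF f'(1) g'(1)] cu_path_tensor[OF f(1) g(1)]]
      using k(1) by blast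
  qed
  fix c :: "nat \<Rightarrow> ('s1, 't1) ihom" and d :: "nat \<Rightarrow> ('s2, 't2) ihom"
  assume c: "incseq c" and d: "incseq d" and cx: "is_lub (range c) x" and dy: "is_lub (range d) y"
  obtain F where F: "\<And>n. cu_path (F n)" "c = (\<lambda>n. path_class (F n))" "\<And>n. F n \<lesssim> F (Suc n)"
    using c by (rule ihom_seq_paths) blast
  obtain G where G: "\<And>n. cu_path (G n)" "d = (\<lambda>n. path_class (G n))" "\<And>n. G n \<lesssim> G (Suc n)"
    using d by (rule ihom_seq_paths) blast
  have "is_lub (range (\<lambda>n. abs_ihom (\<lambda>l. tensor_map (F n l) (G n l)))) (abs_ihom (\<lambda>l. tensor_map (f l) (g l)))"
  proof (rule ihom_lubI)
    show "cu_path (\<lambda>l. tensor_map (F n l) (G n l))" for n by (rule cu_path_tensor[OF F(1) G(1)])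
    show "cu_path (\<lambda>l. tensor_map (f l) (g l))" by (rule cu_path_tensor[OF f(1) g(1)])
    show "(\<lambda>l. tensor_map (F n l) (G n l)) \<lesssim> (\<lambda>l. tensor_map (f l) (g l))" for n
    proof (rule path_tensor_le[OF F(1) G(1) f(1) g(1)])
      show "F n \<lesssim> f" using is_lub_upper[OF cx, of "c n"] F(1,2) f by (simp add: path_class_le_iff)
      show "G n \<lesssim> g" using is_lub_upper[OF dy, of "d n"] G(1,2) g by (simp add: path_class_le_iff)
    qed
    fix t assume t: "t \<in> IQ"
    \<comment> \<open>The members \<open>f t\<close> and \<open>g t\<close> precede members of
      \<open>F n\<close> and \<open>G n'\<close> for unrelated \<open>n\<close> and
      \<open>n'\<close>. Both are moved to stage \<open>max n n'\<close>, after which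
      \<open>path_tensor_prec\<close> equalizes the path indices.\<close>
    obtain n m where nm: "m \<in> IQ" "f t \<prec> F n m"
      using ihom_lubD[of F, OF F(1,3) f(1) _ t] cx F(2) f(2) by (auto simp: path_class_def)
    obtain n' m' where nm': "m' \<in> IQ" "g t \<prec> G n' m'"
      using ihom_lubD[of G, OF G(1,3) g(1) _ t] dy G(2) g(2) by (auto simp: path_class_def)
    have "F n \<lesssim> F (max n n')" using incseqD[OF c, of n "max n n'"] F(1,2) by (simp add: path_class_le_iff)
    then obtain k where k: "k \<in> IQ" "f t \<prec> F (max n n') k"
      using nm prec_trans unfolding path_le_def by metis
    have "G n' \<lesssim> G (max n n')" using incseqD[OF d, of n' "max n n'"] G(1,2) by (simp add: path_class_le_iff)
    then obtain k' where k': "k' \<in> IQ" "g t \<prec> G (max n n') k'"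
      using nm' prec_trans unfolding path_le_def by metis
    show "\<exists>n. \<exists>m\<in>IQ. tensor_map (f t) (g t) \<prec> tensor_map (F n m) (G n m)"
      using path_tensor_prec[OF F(1) G(1) mor(1)[OF t] mor(3)[OF t] k(1) k'(1) k(2) k'(2)] by blast
  qed
  then show "is_lub (range (\<lambda>n. ihom_tensor (c n) (d n))) (ihom_tensor x y)"
    using f g F(1,2) G(1,2) by (simp add: ihom_tensor_path_class) (simp add: path_class_def)
qed

section \<open>Identification with the external tensor product\<close>

text \<open>All endpoints involved are suprema along the same \<open>IQ_seq\<close>, and
  \<open>\<otimes>\<close> preserves suprema taken simultaneously in both variables.\<close>

lemma endpoint_ihom_tensor:
  "endpoint (ihom_tensor x y) (a \<otimes> b) = endpoint x a \<otimes> endpoint y b"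
proof -
  obtain f where f: "cu_path f" "x = path_class f" by (rule ihom_path_cases)
  obtain g where g: "cu_path g" "y = path_class g" by (rule ihom_path_cases)
  note seq = path_IQ_seq_incseq endpoint_seq_lub
  have "is_lub (range (\<lambda>n. f (IQ_seq n) a \<otimes> g (IQ_seq n) b)) (endpoint x a \<otimes> endpoint y b)"
    unfolding f(2) g(2) by (intro gen_bimorphism_lub[OF simple_tensor_gen] seq f(1) g(1))
  then have "is_lub (range (\<lambda>n. tensor_map (f (IQ_seq n)) (g (IQ_seq n)) (a \<otimes> b))) (endpoint x a \<otimes> endpoint y b)"
    by (simp add: tensor_map_simple cu_path_morphism[OF f(1)] cu_path_morphism[OF g(1)] IQ_seq_mem)
  then show ?thesis
    unfolding f(2) g(2) ihom_tensor_path_class[OF f(1) g(1)]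
    by (rule is_lub_unique[OF endpoint_seq_lub[OF cu_path_tensor[OF f(1) g(1)]]])
qed

lemma ext_tensor_map_eq: "ext_tensor_map = tensor_lift ihom_tensor"
  unfolding ext_tensor_map_def
proof (rule the_equality)
  note L = cu_morphism_tensor_lift[OF cu_bimorphism_ihom_tensor]
  note E = cu_morphism_eval_map
  \<comment> \<open>Both sides send \<open>(x \<otimes> y) \<otimes> (a \<otimes> b)\<close> to
    \<open>endpoint x a \<otimes> endpoint y b\<close>, and such elements determine a generalized
    Cu-morphism.\<close>
  have "adjunct (tensor_lift ihom_tensor) = tensor_map eval_map eval_map \<circ> tensor_mid_flip"
    by (intro gen_morphism_eq_four cu_morphism_gen cu_morphism_adjunct L
        cu_morphism_comp cu_morphism_tensor_map E cu_morphism_tensor_mid_flip)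
      (simp add: adjunct_simple[OF L] tensor_lift_simple[OF cu_bimorphism_ihom_tensor]
        tensor_mid_flip_simple tensor_map_simple cu_morphism_gen[OF E] eval_map_simple endpoint_ihom_tensor)
  with L show *: "cu_morphism (tensor_lift ihom_tensor) \<and>
      adjunct (tensor_lift ihom_tensor) = tensor_map eval_map eval_map \<circ> tensor_mid_flip" by blast
  \<comment> \<open>Uniqueness in the definite description is injectivity of the adjunction.\<close>
  show "\<alpha> = tensor_lift ihom_tensor"
    if "cu_morphism \<alpha> \<and> adjunct \<alpha> = tensor_map eval_map eval_map \<circ> tensor_mid_flip" for \<alpha>
    using that * by (metis adjunct_inj)
qed

theorem theorem3p13:
  fixes f :: "rat \<Rightarrow> 's1::cu_semigroup \<Rightarrow> 't1::cu_semigroup"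
    and g :: "rat \<Rightarrow> 's2::cu_semigroup \<Rightarrow> 't2::cu_semigroup"
  assumes "cu_path f" and "cu_path g"
  shows "cu_path (\<lambda>l. tensor_map (f l) (g l)) \<and>
    path_class f \<boxtimes> path_class g = path_class (\<lambda>l. tensor_map (f l) (g l))"
  using cu_path_tensor[OF assms] ihom_tensor_path_class[OF assms]
  by (simp add: ext_tensor_def ext_tensor_map_eq tensor_lift_simple[OF cu_bimorphism_ihom_tensor])

end
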